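(* Let $x$, $y$, $z$ be even non-negative integers, let $k\ge 1$ and let $a_1,\dotsc,a_k$ be non-negative integers. Put $a_{k+i}:=a_{k-i+1}$ for $i=1,\dotsc,k$, so that $(a_1,\dotsc,a_{2k})=(a_1,\dotsc,a_k,a_k,\dotsc,a_1)$, and let $a:=a_1+\cdots+a_k$. Then \[ \frac{\mathrm{M}_{\odot}(FC_{x,y,z}(a_1,\dotsc,a_k,a_k,\dotsc,a_1))}{\mathrm{M}_{\odot}(FC_{x,y,z}(a,a))} =\sqrt{\frac{\mathrm{M}(FC_{x,y,z}(a_1,\dotsc,a_k,a_k,\dotsc,a_1))}{\mathrm{M}(FC_{x,y,z}(a,a))}} \] and both sides are equal to \[ s(a_1,\dotsc,a_k,a_k,\dotsc,a_1)\, \frac{\mathrm{h}(\frac{x+z}{2}+a)}{\mathrm{h}(\frac{x+y}{2}+a)} \prod_{i\ge 0,\ 1\le 2i+1\le 2k}\frac{\mathrm{h}(\frac{x+y}{2}+a_1+\cdots+a_{2i+1})}{\mathrm{h}(\frac{x+z}{2}+a_1+\cdots+a_{2i+1})} \prod_{i\ge 1,\ 1<2i<2k}\frac{\mathrm{h}(\frac{x+z}{2}+a_1+\cdots+a_{2i})}{\mathrm{h}(\frac{x+y}{2}+a_1+\cdots+a_{2i})}. \]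
   Context: We work on the triangular lattice with one family of lattice lines horizontal; its faces are unit up-pointing and down-pointing triangles. A lozenge is the union of two unit triangles sharing an edge; a lozenge tiling of a lattice region $R$ is a covering of $R$ by lozenges without gaps or overlaps. $\mathrm{M}(R)$ denotes the number of lozenge tilings of $R$; if $R$ is centrally symmetric, $\mathrm{M}_\odot(R)$ denotes the number of lozenge tilings of $R$ invariant under the rotation by $180^\circ$ about the center of $R$. Fern: for non-negative integers $b_1,\dotsc,b_m$, the fern $F(b_1,\dotsc,b_m)$ is a string of $m$ lattice triangles lined up along a horizontal lattice line, consecutive ones touching at a vertex, of side lengths $b_1,\dotsc,b_m$ from left to right, alternately pointing up and down with the leftmost (the one of size $b_1$) pointing up (a triangle of size $0$ is a single point). Its base point is its leftmost point. Fern-cored hexagon: let $x,y,z$ be even non-negative integers and $a=a_1+\cdots+a_k$. Let $H$ be the lattice hexagon with side lengths $x+a$, $y+a$, $z+a$, $x+a$, $y+a$, $z+a$ listed clockwise starting from the (horizontal) top side. The auxiliary hexagon $\bar H$ is the hexagon of side lengths $x,y,z,x,y,z$ (clockwise from top) that fits in the western corner of $H$ (sharing that corner and the directions of the two sides meeting there); its center is a lattice point. For a list $(b_1,\dots,b_m)$ with (sum of odd-indexed entries) $=$ (sum of even-indexed entries) $=a$, the region $FC_{x,y,z}(b_1,\dotsc,b_m)$ is obtained from $H$ by removing the fern $F(b_1,\dotsc,b_m)$ translated so that its base point is the center of $\bar H$ (equivalently, the fern lies on the horizontal lattice line through the center of $H$ and is centered at the center of $H$). In particular $FC_{x,y,z}(a,a)$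 has a removed two-lobed fern $F(a,a)$, and $FC_{x,y,z}(a_1,\dotsc,a_k,a_k,\dotsc,a_1)$ has removed fern $F(a_1,\dotsc,a_k,a_k,\dotsc,a_1)$; both regions are centrally symmetric about the center of $H$. Hyperfactorial: $\mathrm{h}(n):=0!\,1!\cdots(n-1)!$ (with $\mathrm{h}(0)=1$). The function $s$: for non-negative integers $b_1,\dotsc,b_{2l}$ set $s(b_1,\dotsc,b_{2l}):=s(b_1,\dotsc,b_{2l-1})$, and \[ s(b_1,\dotsc,b_{2l-1}):=\frac{\prod_{1\le i\le j\le 2l-1,\ j-i+1\text{ odd}}\mathrm{h}(b_i+b_{i+1}+\cdots+b_j)}{\prod_{1\le i\le j\le 2l-1,\ j-i+1\text{ even}}\mathrm{h}(b_i+b_{i+1}+\cdots+b_j)}\cdot\frac{1}{\mathrm{h}(b_1+b_3+\cdots+b_{2l-1})}. \] (This equals the number of lozenge tilings of a semihexagon whose base has alternately removed/kept segments of lengths $b_1,b_2,\dots$ of up-pointing unit triangles.) *)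

theory Defs
  imports Complex_Main
begin

text \<open>
  The lattice point \<open>(i, j)\<close> stands for \<open>i e\<^sub>1 + j e\<^sub>2\<close>, where \<open>e\<^sub>1 = (1, 0)\<close> points east and
  \<open>e\<^sub>2 = (1/2, sqrt 3 / 2)\<close> points north-east; south-east is \<open>e\<^sub>1 - e\<^sub>2\<close>.  Horizontal lattice lines
  are the lines of constant \<open>j\<close>.
\<close>

type_synonym point = "int \<times> int"

datatype unit_triangle = Up int int | Down int int

fun vertices :: "unit_triangle \<Rightarrow> point set" where
  "vertices (Up i j) = {(i, j), (i + 1, j), (i, j + 1)}"
| "vertices (Down i j) = {(i + 1, j), (i, j + 1), (i + 1, j + 1)}"

text \<open>
  A lattice region is a set of unit triangles.  The region cut out by a convex lattice polygon
  consists of the unit triangles all of whose vertices lie in the polygon.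
\<close>

type_synonym region = "unit_triangle set"

definition region_of :: "point set \<Rightarrow> region" where
  "region_of P = {t. vertices t \<subseteq> P}"

definition is_lozenge :: "unit_triangle set \<Rightarrow> bool" where
  "is_lozenge L \<longleftrightarrow> (\<exists>s t. L = {s, t} \<and> s \<noteq> t \<and> card (vertices s \<inter> vertices t) = 2)"

definition is_tiling :: "region \<Rightarrow> unit_triangle set set \<Rightarrow> bool" where
  "is_tiling R T \<longleftrightarrow> (\<forall>L\<in>T. is_lozenge L) \<and> pairwise disjnt T \<and> \<Union>T = R"

definition M :: "region \<Rightarrow> nat" where
  "M R = card {T. is_tiling R T}"

text \<open>
  The rotation by 180 degrees about a centre \<open>c\<close> is \<open>v \<mapsto> 2 c - v\<close>.  The first argument \<open>d\<close>
  below is the doubled centre \<open>2 c\<close>.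
\<close>

fun rotate_point :: "point \<Rightarrow> point \<Rightarrow> point" where
  "rotate_point (d1, d2) (i, j) = (d1 - i, d2 - j)"

fun rotate_triangle :: "point \<Rightarrow> unit_triangle \<Rightarrow> unit_triangle" where
  "rotate_triangle (d1, d2) (Up i j) = Down (d1 - i - 1) (d2 - j - 1)"
| "rotate_triangle (d1, d2) (Down i j) = Up (d1 - i - 1) (d2 - j - 1)"

lemma vertices_rotate_triangle:
  "vertices (rotate_triangle d t) = rotate_point d ` vertices t"
  by (cases d; cases t) auto

definition M_odot :: "point \<Rightarrow> region \<Rightarrow> nat" where
  "M_odot d R = card {T. is_tiling R T \<and> (`) (rotate_triangle d) ` T = T}"

text \<open>
  The hexagon with side lengths \<open>X, Y, Z, X, Y, Z\<close> clockwise from the top side and western corner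
  \<open>(0, 0)\<close>; its remaining corners are, clockwise, \<open>(0, Z)\<close>, \<open>(X, Z)\<close>, \<open>(X + Y, Z - Y)\<close>,
  \<open>(X + Y, - Y)\<close> and \<open>(Y, - Y)\<close>, so its doubled centre is \<open>(X + Y, Z - Y)\<close>.
\<close>

definition hexagon :: "nat \<Rightarrow> nat \<Rightarrow> nat \<Rightarrow> region" where
  "hexagon X Y Z = region_of {(i, j). 0 \<le> i \<and> i \<le> int X + int Y
      \<and> - int Y \<le> j \<and> j \<le> int Z \<and> 0 \<le> i + j \<and> i + j \<le> int X + int Z}"

definition hexagon_centre2 :: "nat \<Rightarrow> nat \<Rightarrow> nat \<Rightarrow> point" where
  "hexagon_centre2 X Y Z = (int X + int Y, int Z - int Y)"

text \<open>
  The lattice triangles of side \<open>b\<close> whose horizontal side has left endpoint \<open>(p, q)\<close>: the third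
  corner is \<open>(p, q + b)\<close> for the up-pointing and \<open>(p + b, q - b)\<close> for the down-pointing one.
\<close>

definition up_triangle :: "point \<Rightarrow> nat \<Rightarrow> region" where
  "up_triangle = (\<lambda>(p, q) b. region_of {(i, j). p \<le> i \<and> q \<le> j \<and> i + j \<le> p + q + int b})"

definition down_triangle :: "point \<Rightarrow> nat \<Rightarrow> region" where
  "down_triangle = (\<lambda>(p, q) b. region_of {(i, j). i \<le> p + int b \<and> j \<le> q \<and> p + q \<le> i + j})"

text \<open>
  Lists are indexed from 0, so the odd-indexed entries \<open>b\<^sub>1, b\<^sub>3, \<dots>\<close> sit at the even positions.
\<close>

definition fern :: "point \<Rightarrow> nat list \<Rightarrow> region" where
  "fern = (\<lambda>(p, q) bs. \<Union>i<length bs.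
      (let v = (p + int (sum_list (take i bs)), q)
       in if even i then up_triangle v (bs ! i) else down_triangle v (bs ! i)))"

definition odd_sum :: "nat list \<Rightarrow> nat" where
  "odd_sum bs = (\<Sum>i | i < length bs \<and> even i. bs ! i)"

text \<open>
  Fern-cored hexagons, intended for even \<open>x, y, z\<close> and lists whose odd-indexed and even-indexed
  entries have the same sum.  The base point of the fern is the centre of the hexagon with sides
  \<open>x, y, z, x, y, z\<close> in the western corner.
\<close>

definition FC :: "nat \<Rightarrow> nat \<Rightarrow> nat \<Rightarrow> nat list \<Rightarrow> region" where
  "FC x y z bs = (let a = odd_sum bs in
      hexagon (x + a) (y + a) (z + a)
        - fern ((int x + int y) div 2, (int z - int y) div 2) bs)"

definition FC_centre2 :: "nat \<Rightarrow> nat \<Rightarrow> nat \<Rightarrow> nat list \<Rightarrow> point" where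
  "FC_centre2 x y z bs = (let a = odd_sum bs in hexagon_centre2 (x + a) (y + a) (z + a))"

definition h :: "nat \<Rightarrow> nat" where
  "h n = (\<Prod>i<n. fact i)"

definition s_odd :: "nat list \<Rightarrow> real" where
  "s_odd bs =
     (\<Prod>(i, j) | i \<le> j \<and> j < length bs \<and> odd (j - i + 1). real (h (\<Sum>t=i..j. bs ! t)))
   / (\<Prod>(i, j) | i \<le> j \<and> j < length bs \<and> even (j - i + 1). real (h (\<Sum>t=i..j. bs ! t)))
   * (1 / real (h (odd_sum bs)))"

definition s :: "nat list \<Rightarrow> real" where
  "s bs = (if even (length bs) then s_odd (butlast bs) else s_odd bs)"

end

theory Submission
  imports Defs "Jordan_Normal_Form.Determinant"
begin

text \<open>
  Cut the hexagon along the horizontal line through its centre.  A tiling is determined by the set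
  \<open>S\<close> of positions of the lozenges crossing this line and by tilings of the two halves.  The upper
  half is a trapezoid with dents along its base at \<open>S\<close>, at the up-pointing lobes \<open>U\<close> of the fern and
  at one corner \<open>C\<close>: removing a triangle standing on the base amounts to removing the unit triangles
  in its bottom row, since the rest of it is then filled by forced lozenges.  Such a trapezoid with
  \<open>n\<close> dents has \<open>\<Delta> / h n\<close> tilings, where \<open>\<Delta>\<close> is the product of the distances of the dents.

  The lower half is the upper half turned around, with \<open>S\<close> replaced by its mirror image.  As the
  up-pointing lobes and their mirror images fill the whole fern, the factors in which \<open>S\<close> interacts
  with \<open>U\<close> multiply up to a quantity that does not depend on how the fern is divided into lobes.
  Hence the number of all tilings is \<open>\<Delta>(U \<union> C)\<^sup>2\<close> times, and the number of centrally symmetric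
  tilings is \<open>\<Delta>(U \<union> C)\<close> times, a constant independent of the lobes.
\<close>

section \<open>Interlacing sequences and binomial determinants\<close>

text \<open>The dent formula comes from a transfer argument between consecutive rows. A single row
  has at most one tiling, and has one exactly when the dents on its lower and upper sides interlace.
  The determinant with entries binom(c_i, j) reproduces itself under summation over interlacing
  sequences, because summing a binomial coefficient over an interval raises its lower index; it is
  also a Vandermonde product divided by factorials.

  The sums over \<open>S\<close> are never evaluated. They cancel in the ratios, which is legitimate
  only if they are nonzero, so one mirror-symmetric admissible \<open>S\<close> has to be exhibited.
  In the symmetric count \<open>S\<close> is its own mirror image, so the two halves contribute
  equally and one half contributes a square root.

  What remains is \<open>\<Delta>(U \<union> C)\<close>, which splits into three factors: that of
  \<open>U\<close> is \<open>s\<close> times a hyperfactorial of \<open>a\<close>, that of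
  \<open>C\<close> is common to both ferns, and the distances between \<open>U\<close> and
  \<open>C\<close> give the quotients with \<open>(x + y) / 2\<close> and
  \<open>(x + z) / 2\<close>.\<close>

text \<open>The condition is half-open because of the slanted coordinates: \<open>Down i j\<close>
  lies between \<open>Up i j\<close> and \<open>Up (i + 1) j\<close>, so an upper dent with index
  \<open>t\<close> stands half a step to the right of a lower one with the same index.\<close>

fun interlaces :: "int list \<Rightarrow> int list \<Rightarrow> bool" where
  "interlaces [a] [] \<longleftrightarrow> True"
| "interlaces (a # b # xs) (t # u) \<longleftrightarrow> a \<le> t \<and> t < b \<and> interlaces (b # xs) u"
| "interlaces _ _ \<longleftrightarrow> False"

lemma interlaces_singleton [simp]: "interlaces [a] t \<longleftrightarrow> t = []"
  by (cases t) auto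

lemma interlaces_Cons2:
  "{t. interlaces (a # b # xs) t} = (\<lambda>(t, u). t # u) ` ({a..<b} \<times> {u. interlaces (b # xs) u})"
proof -
  have "interlaces (a # b # xs) t \<longleftrightarrow>
     t \<in> (\<lambda>(t, u). t # u) ` ({a..<b} \<times> {u. interlaces (b # xs) u})" for t
    by (cases t) (auto simp: image_iff)
  then show ?thesis by blast
qed

lemma interlaces_length: "interlaces xs t \<Longrightarrow> length xs = Suc (length t)"
  by (induction xs t rule: interlaces.induct) auto


lemma interlaces_bounds:
  "interlaces xs t \<Longrightarrow> sorted_wrt (<) xs \<Longrightarrow> x \<in> set t \<Longrightarrow> hd xs \<le> x \<and> x < last xs"
proof (induction xs t rule: interlaces.induct)
  case (2 a b xs t u)
  have "b \<le> last (b # xs)" using 2(3) last_in_set[of xs] by (cases "xs = []") (auto simp: less_imp_le)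
  then show ?case using 2(1)[OF _ _ ] 2(2-4) by (cases "x = t") fastforce+
qed auto

lemma interlaces_strict_sorted:
  "interlaces xs t \<Longrightarrow> sorted_wrt (<) xs \<Longrightarrow> sorted_wrt (<) t"
proof (induction xs t rule: interlaces.induct)
  case (2 a b xs t u)
  have "t < x" if "x \<in> set u" for x
    using interlaces_bounds[of "b # xs" u x] 2 that by auto
  then show ?case using 2 by auto
qed auto

section \<open>Multilinearity and discrete integration of determinants\<close>

text \<open>Rows are infinite sequences cut off at the number of rows, so the same row can serve in
  determinants of different sizes and can be replaced inside a list.\<close>

definition rowdet :: "(nat \<Rightarrow> real) list \<Rightarrow> real" where
  "rowdet rs = det (mat (length rs) (length rs) (\<lambda>(i, j). (rs ! i) j))"

lemma rowdet_sum:
  "rowdet (pre @ (\<lambda>j. \<Sum>t\<in>X. \<phi> t j) # post) = (\<Sum>t\<in>X. rowdet (pre @ \<phi> t # post))"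
proof -
  define n where "n = Suc (length pre + length post)"
  define k where "k = length pre"
  have k: "k \<in> {0..<n}" by (simp add: k_def n_def)
  \<comment> \<open>In the Leibniz expansion every term uses row \<open>k\<close> exactly once;
    \<open>c p\<close> is the rest of the term. Row \<open>k\<close> is never read there, so
    \<open>undefined\<close> can hold its place.\<close>
  define c where "c p = signof p * (\<Prod>i\<in>{0..<n} - {k}. ((pre @ undefined # post) ! i) (p i))" for p
  have expand: "rowdet (pre @ r # post) = (\<Sum>p | p permutes {0..<n}. c p * r (p k))" for r
  proof -
    have "rowdet (pre @ r # post)
        = (\<Sum>p | p permutes {0..<n}. signof p * (\<Prod>i = 0..<n. ((pre @ r # post) ! i) (p i)))"
      unfolding rowdet_def det_def
      by (auto simp: n_def permutes_in_image intro!: sum.cong prod.cong)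
    also have "\<dots> = (\<Sum>p | p permutes {0..<n}. c p * r (p k))"
    proof (intro sum.cong refl)
      fix p
      have "(\<Prod>i = 0..<n. ((pre @ r # post) ! i) (p i))
          = r (p k) * (\<Prod>i\<in>{0..<n} - {k}. ((pre @ r # post) ! i) (p i))"
        by (subst prod.remove[OF finite_atLeastLessThan k]) (simp add: k_def)
      also have "(\<Prod>i\<in>{0..<n} - {k}. ((pre @ r # post) ! i) (p i))
          = (\<Prod>i\<in>{0..<n} - {k}. ((pre @ undefined # post) ! i) (p i))"
        by (intro prod.cong) (auto simp: k_def nth_append nth_Cons')
      finally show "signof p * (\<Prod>i = 0..<n. ((pre @ r # post) ! i) (p i)) = c p * r (p k)"
        by (simp add: c_def)
    qed
    finally show ?thesis .
  qed
  show ?thesis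
    unfolding expand by (subst sum.swap) (simp add: sum_distrib_left)
qed

text \<open>The entries of an interlacing sequence range independently over the gaps of
  \<open>xs\<close>, so multilinearity moves each summation into its own row. The induction fixes
  the first entry and appends its row to \<open>pre\<close>.\<close>

lemma sum_rowdet_interlaces:
  "xs \<noteq> [] \<Longrightarrow> (\<Sum>t | interlaces xs t. rowdet (pre @ map \<phi> t))
     = rowdet (pre @ map (\<lambda>(a, b) j. \<Sum>t = a..<b. \<phi> t j) (zip xs (tl xs)))"
proof (induction xs arbitrary: pre)
  case (Cons a xs)
  show ?case
  proof (cases xs)
    case Nil
    then show ?thesis by simp
  next
    case (Cons b xs')
    let ?d = "map (\<lambda>(a, b) j. \<Sum>t = a..<b. \<phi> t j) (zip xs (tl xs))"
    have "(\<Sum>t | interlaces (a # xs) t. rowdet (pre @ map \<phi> t))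
        = (\<Sum>t = a..<b. \<Sum>u | interlaces xs u. rowdet ((pre @ [\<phi> t]) @ map \<phi> u))"
      unfolding Cons interlaces_Cons2
      by (subst sum.reindex) (auto simp: inj_on_def sum.cartesian_product intro!: sum.cong)
    also have "\<dots> = (\<Sum>t = a..<b. rowdet (pre @ \<phi> t # ?d))"
      using Cons Cons.IH[of "pre @ [\<phi> _]"] by simp
    also have "\<dots> = rowdet (pre @ (\<lambda>j. \<Sum>t = a..<b. \<phi> t j) # ?d)"
      by (rule rowdet_sum [symmetric])
    finally show ?thesis by (simp add: Cons)
  qed
qed simp

definition binom_row :: "int \<Rightarrow> nat \<Rightarrow> real" where
  "binom_row c j = of_int c gchoose j"

text \<open>Pascal's rule makes the sum telescope. Such an exact antiderivative is the reason for
  using binomial coefficients instead of powers.\<close>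

lemma sum_binom_row:
  "a \<le> b \<Longrightarrow> (\<Sum>t = a..<b. binom_row t j) = binom_row b (Suc j) - binom_row a (Suc j)"
proof (induction b rule: int_ge_induct)
  case (step i)
  have "{a..<i + 1} = insert i {a..<i}" using step by auto
  then show ?case
    using step gbinomial_Suc_Suc[of "of_int i :: real" j] by (simp add: binom_row_def add.commute)
qed simp

text \<open>Column 0 consists of ones. Subtracting from each row its predecessor, which is
  multiplication by \<open>L\<close>, turns this column into the first unit vector; expanding along
  it deletes the first row and column and leaves the differences.\<close>

lemma rowdet_binom_differences:
  "rowdet (map binom_row (a # xs))
     = rowdet (map (\<lambda>(a, b) j. binom_row b (Suc j) - binom_row a (Suc j)) (zip (a # xs) xs))"
    (is "rowdet ?rs = rowdet ?ds")
proof -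
  define n where "n = length xs"
  define S where "S = a # xs"
  define A where "A = mat (Suc n) (Suc n) (\<lambda>(i, j). binom_row (S ! i) j)"
  define L where "L = mat (Suc n) (Suc n) (\<lambda>(i, j). if i = j then 1 else if i = Suc j then -1 else 0 :: real)"
  define D where "D = mat n n (\<lambda>(i, j). binom_row (S ! Suc i) (Suc j) - binom_row (S ! i) (Suc j))"
  have A: "rowdet ?rs = det A"
    unfolding rowdet_def A_def S_def
    by (rule arg_cong[where f = det]) (auto simp: n_def intro!: eq_matI simp del: list.map)
  have D: "rowdet ?ds = det D"
    unfolding rowdet_def D_def S_def
    by (rule arg_cong[where f = det]) (auto simp: n_def intro!: eq_matI)
  have carr: "A \<in> carrier_mat (Suc n) (Suc n)" "L \<in> carrier_mat (Suc n) (Suc n)"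
    by (auto simp: A_def L_def)
  have "det L = prod_list (diag_mat L)"
    by (rule det_lower_triangular[OF _ carr(2)]) (auto simp: L_def)
  also have "\<dots> = 1"
    by (simp add: prod_list_diag_prod L_def)
  finally have detL: "det L = 1" .
  have LA: "(L * A) $$ (i, j) = (if i = 0 then binom_row (S ! 0) j
      else binom_row (S ! i) j - binom_row (S ! (i - 1)) j)" if "i < Suc n" "j < Suc n" for i j
  proof -
    have "(L * A) $$ (i, j) = (\<Sum>k = 0..<Suc n. L $$ (i, k) * A $$ (k, j))"
      using that carr by (auto simp: scalar_prod_def intro!: sum.cong)
    also have "\<dots> = (\<Sum>k = 0..<Suc n. (if k = i then binom_row (S ! i) j else 0)
        + (if i > 0 \<and> k = i - 1 then - binom_row (S ! (i - 1)) j else 0))"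
      using that by (intro sum.cong) (auto simp: L_def A_def)
    also have "\<dots> = (if i = 0 then binom_row (S ! 0) j
      else binom_row (S ! i) j - binom_row (S ! (i - 1)) j)"
      using that unfolding sum.distrib by (cases i) (auto)
    finally show ?thesis .
  qed
  have carrLA: "L * A \<in> carrier_mat (Suc n) (Suc n)" using carr by simp
  have "det A = det (L * A)" using detL carr det_mult[of L "Suc n" A] by simp
  also have "\<dots> = (\<Sum>i<Suc n. (L * A) $$ (i, 0) * cofactor (L * A) i 0)"
    by (rule laplace_expansion_column[OF carrLA]) simp
  also have "\<dots> = (\<Sum>i<Suc n. if i = 0 then cofactor (L * A) 0 0 else 0)"
    by (intro sum.cong) (auto simp: LA binom_row_def simp del: index_mult_mat)
  also have "\<dots> = cofactor (L * A) 0 0" by simp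
  also have "\<dots> = det (mat_delete (L * A) 0 0)" by (simp add: cofactor_def)
  also have "mat_delete (L * A) 0 0 = D"
  proof (rule eq_matI)
    fix i j assume "i < dim_row D" "j < dim_col D"
    then show "mat_delete (L * A) 0 0 $$ (i, j) = D $$ (i, j)"
      using LA[of "Suc i" "Suc j"] carr by (simp add: mat_delete_def D_def del: index_mult_mat(1))
  qed (use carr in \<open>auto simp: D_def\<close>)
  finally show ?thesis using A D by simp
qed

text \<open>Summation produces rows of differences, and these form a determinant one size larger.
  This is the recursion that the tilings of a trapezoid obey when its bottom row is split
  off.\<close>

lemma sum_rowdet_binom_interlaces:
  assumes "sorted xs" "xs \<noteq> []"
  shows "(\<Sum>t | interlaces xs t. rowdet (map binom_row t)) = rowdet (map binom_row xs)"
proof -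
  obtain a xs' where xs: "xs = a # xs'" using assms(2) by (cases xs) auto
  have "(\<Sum>t | interlaces xs t. rowdet (map binom_row t))
      = rowdet (map (\<lambda>(a, b) j. \<Sum>t = a..<b. binom_row t j) (zip xs (tl xs)))"
    using sum_rowdet_interlaces[OF assms(2), of "[]" binom_row] by simp
  also have "map (\<lambda>(a, b) j. \<Sum>t = a..<b. binom_row t j) (zip xs (tl xs))
      = map (\<lambda>(a, b) j. binom_row b (Suc j) - binom_row a (Suc j)) (zip xs (tl xs))"
    (is "?l = ?r")
  proof (rule nth_equalityI)
    fix i assume "i < length ?l"
    then have "xs ! i \<le> xs ! Suc i" using assms(1) by (auto simp: sorted_iff_nth_mono)
    with \<open>i < length ?l\<close> show "?l ! i = ?r ! i"
      by (auto simp: sum_binom_row nth_tl)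
  qed simp
  finally show ?thesis using rowdet_binom_differences[of a xs'] by (simp add: xs)
qed

text \<open>Any polynomials \<open>p\<^sub>j\<close> of degree at most \<open>j\<close> arise from the monomials by an upper triangular
  change of basis.\<close>

lemma det_poly_eval:
  fixes p :: "nat \<Rightarrow> real poly"
  assumes "\<And>j. degree (p j) \<le> j"
  shows "det (mat n n (\<lambda>(i, j). poly (p j) (c i)))
     = det (mat n n (\<lambda>(i, j). c i ^ j)) * (\<Prod>j<n. coeff (p j) j)"
proof -
  define V where "V = mat n n (\<lambda>(i, j). c i ^ j)"
  define C where "C = mat n n (\<lambda>(k, j). coeff (p j) k)"
  have carr: "V \<in> carrier_mat n n" "C \<in> carrier_mat n n" by (auto simp: V_def C_def)
  have "mat n n (\<lambda>(i, j). poly (p j) (c i)) = V * C"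
  proof (rule eq_matI)
    fix i j assume "i < dim_row (V * C)" "j < dim_col (V * C)"
    then have ij: "i < n" "j < n" by (auto simp: V_def C_def)
    have "poly (p j) (c i) = (\<Sum>k\<le>degree (p j). coeff (p j) k * c i ^ k)"
      by (rule poly_altdef)
    also have "\<dots> = (\<Sum>k = 0..<n. coeff (p j) k * c i ^ k)"
      using assms[of j] ij by (intro sum.mono_neutral_left) (auto simp: coeff_eq_0)
    also have "\<dots> = (V * C) $$ (i, j)"
      using ij by (auto simp: V_def C_def scalar_prod_def intro!: sum.cong)
    finally show "mat n n (\<lambda>(i, j). poly (p j) (c i)) $$ (i, j) = (V * C) $$ (i, j)"
      using ij by simp
  qed (auto simp: V_def C_def)
  moreover have "det C = prod_list (diag_mat C)"
    using le_less_trans[OF assms] by (intro det_upper_triangular[OF _ carr(2)])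
      (auto simp: C_def upper_triangular_def coeff_eq_0)
  moreover have "prod_list (diag_mat C) = (\<Prod>j<n. coeff (p j) j)"
    by (simp add: prod_list_diag_prod C_def lessThan_atLeast0)
  ultimately show ?thesis using det_mult[OF carr] by (simp add: V_def)
qed

lemma prod_linear_monic:
  fixes f :: "nat \<Rightarrow> real"
  shows "degree (\<Prod>l<j. [:- f l, 1:]) = j \<and> coeff (\<Prod>l<j. [:- f l, 1:]) j = 1"
proof (induction j)
  case (Suc j)
  let ?p = "\<Prod>l<j. [:- f l, 1:]"
  have ne: "?p \<noteq> 0" using Suc by force
  have "degree (?p * [:- f j, 1:]) = Suc j"
    using Suc ne by (subst degree_mult_eq) auto
  moreover have "lead_coeff (?p * [:- f j, 1:]) = 1"
    using Suc by (simp only: lead_coeff_mult) simp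
  ultimately show ?case by (metis prod.lessThan_Suc)
qed auto

text \<open>The Newton polynomial \<open>p j\<close> vanishes at \<open>c i\<close> for
  \<open>i < j\<close>, so the evaluation matrix is triangular; as these polynomials are monic, its
  determinant is that of the monomials.\<close>

lemma vandermonde:
  fixes c :: "nat \<Rightarrow> real"
  shows "det (mat n n (\<lambda>(i, j). c i ^ j)) = (\<Prod>i<n. \<Prod>l<i. c i - c l)"
proof -
  define p where "p j = (\<Prod>l<j. [:- c l, 1:])" for j
  define A where "A = mat n n (\<lambda>(i, j). poly (p j) (c i))"
  have "det A = det (mat n n (\<lambda>(i, j). c i ^ j)) * (\<Prod>j<n. coeff (p j) j)"
    unfolding A_def by (rule det_poly_eval) (simp add: p_def prod_linear_monic)
  moreover have "(\<Prod>j<n. coeff (p j) j) = 1" by (simp add: p_def prod_linear_monic)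
  moreover have "det A = prod_list (diag_mat A)"
    by (rule det_lower_triangular[of n]) (auto simp: A_def p_def poly_prod)
  moreover have "\<dots> = (\<Prod>i<n. poly (p i) (c i))"
    by (simp add: prod_list_diag_prod A_def lessThan_atLeast0)
  ultimately show ?thesis by (simp add: p_def poly_prod)
qed

text \<open>\<open>binom_row c j\<close> is a polynomial in \<open>c\<close> of degree
  \<open>j\<close> with leading coefficient \<open>1 / fact j\<close>; the product of these
  factorials is the hyperfactorial in the dent formula.\<close>

lemma rowdet_binom:
  "rowdet (map binom_row xs)
     = (\<Prod>i<length xs. \<Prod>l<i. real_of_int (xs ! i - xs ! l)) / (\<Prod>i<length xs. fact i)"
proof -
  define p :: "nat \<Rightarrow> real poly" where
    "p j = smult (1 / fact j) (\<Prod>l<j. [:- real l, 1:])" for j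
  have "poly (p j) (of_int c) = binom_row c j" for j c
    by (simp add: p_def poly_prod binom_row_def gbinomial_prod_rev lessThan_atLeast0)
  then have "rowdet (map binom_row xs)
      = det (mat (length xs) (length xs) (\<lambda>(i, j). poly (p j) (real_of_int (xs ! i))))"
    unfolding rowdet_def by (auto intro!: arg_cong[where f = det] eq_matI)
  also have "\<dots> = det (mat (length xs) (length xs) (\<lambda>(i, j). real_of_int (xs ! i) ^ j))
      * (\<Prod>j<length xs. coeff (p j) j)"
    by (rule det_poly_eval) (simp add: p_def prod_linear_monic)
  finally show ?thesis
    by (simp add: vandermonde p_def prod_linear_monic prod_dividef)
qed

section \<open>Tilings cut along a horizontal line\<close>

text \<open>Distinct unit triangles of the same orientation share at most one vertex. A lozenge
  therefore has one triangle of each kind, glued along one of the three edges of the up-pointing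
  one.\<close>

lemma is_lozenge_iff:
  "is_lozenge L \<longleftrightarrow> (\<exists>i j. L = {Up i j, Down i j} \<or> L = {Up i j, Down (i - 1) j}
     \<or> L = {Up i j, Down i (j - 1)})" (is "_ \<longleftrightarrow> ?R")
proof
  assume "is_lozenge L"
  then obtain s t where st: "L = {s, t}" "s \<noteq> t" "card (vertices s \<inter> vertices t) = 2"
    by (auto simp: is_lozenge_def)
  then obtain p q where pq: "p \<noteq> q" "p \<in> vertices s" "q \<in> vertices s" "p \<in> vertices t" "q \<in> vertices t"
    by (metis IntD1 IntD2 card_2_iff insertI1 insertI2)
  obtain p1 p2 q1 q2 where [simp]: "p = (p1, p2)" "q = (q1, q2)" by fastforce
  \<comment> \<open>The vertices of a unit triangle are exactly the lattice points satisfying three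
    linear inequalities, which reduces the case analysis to linear integer arithmetic.\<close>
  have U: "(c1, c2) \<in> vertices (Up i j) \<longleftrightarrow> i \<le> c1 \<and> j \<le> c2 \<and> c1 + c2 \<le> i + j + 1" for c1 c2 i j
    by auto
  have D: "(c1, c2) \<in> vertices (Down i j) \<longleftrightarrow> c1 \<le> i + 1 \<and> c2 \<le> j + 1 \<and> i + j + 1 \<le> c1 + c2" for c1 c2 i j
    by auto
  have ne: "p1 \<noteq> q1 \<or> p2 \<noteq> q2" using pq(1) by simp
  have adj: "(k = i \<and> l = j) \<or> (k = i - 1 \<and> l = j) \<or> (k = i \<and> l = j - 1)"
    if "p \<in> vertices (Up i j)" "q \<in> vertices (Up i j)"
       "p \<in> vertices (Down k l)" "q \<in> vertices (Down k l)" for i j k l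
    using that ne unfolding U D \<open>p = _\<close> \<open>q = _\<close> by smt
  show ?R
  proof (cases s; cases t)
    fix i j k l assume *: "s = Up i j" "t = Up k l"
    have "i = k \<and> j = l" using pq(2-5) ne unfolding * U \<open>p = _\<close> \<open>q = _\<close> by smt
    then show ?R using * st(2) by simp
  next
    fix i j k l assume *: "s = Down i j" "t = Down k l"
    have "i = k \<and> j = l" using pq(2-5) ne unfolding * D \<open>p = _\<close> \<open>q = _\<close> by smt
    then show ?R using * st(2) by simp
  next
    fix i j k l assume "s = Up i j" "t = Down k l"
    then show ?R using adj[of i j k l] pq(2-5) st(1) by blast
  next
    fix i j k l assume "s = Down k l" "t = Up i j"
    then show ?R using adj[of i j k l] pq(2-5) st(1) by (metis insert_commute)
  qed
next
  assume ?R
  then obtain i j where "L = {Up i j, Down i j} \<or> L = {Up i j, Down (i - 1) j}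
     \<or> L = {Up i j, Down i (j - 1)}" by blast
  moreover have "vertices (Up i j) \<inter> vertices (Down i j) = {(i + 1, j), (i, j + 1)}"
    "vertices (Up i j) \<inter> vertices (Down (i - 1) j) = {(i, j), (i, j + 1)}"
    "vertices (Up i j) \<inter> vertices (Down i (j - 1)) = {(i, j), (i + 1, j)}"
    by auto
  ultimately show "is_lozenge L"
    unfolding is_lozenge_def by (metis (no_types, lifting) card_2_iff prod.inject
        unit_triangle.distinct(1) add_cancel_left_right zero_neq_one)
qed

definition tilings :: "region \<Rightarrow> unit_triangle set set set" where
  "tilings R = {T. is_tiling R T}"

lemma M_eq_card_tilings: "M R = card (tilings R)"
  by (simp add: M_def tilings_def)

lemma tilingsI:
  "\<lbrakk>\<And>L. L \<in> T \<Longrightarrow> is_lozenge L; \<And>L L'. \<lbrakk>L \<in> T; L' \<in> T; L \<noteq> L'\<rbrakk> \<Longrightarrow> L \<inter> L' = {}; \<Union>T = R\<rbrakk>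
     \<Longrightarrow> T \<in> tilings R"
  by (auto simp: tilings_def is_tiling_def pairwise_def disjnt_def)

lemma tilingsD:
  assumes "T \<in> tilings R"
  shows "L \<in> T \<Longrightarrow> is_lozenge L" "L \<in> T \<Longrightarrow> L' \<in> T \<Longrightarrow> L \<noteq> L' \<Longrightarrow> L \<inter> L' = {}" "\<Union>T = R"
  using assms by (auto simp: tilings_def is_tiling_def pairwise_def disjnt_def)

lemma finite_tilings: "finite R \<Longrightarrow> finite (tilings R)"
  by (rule finite_subset[of _ "Pow (Pow R)"]) (auto dest: tilingsD(3))

lemma is_lozenge_nonempty: "is_lozenge L \<Longrightarrow> L \<noteq> {}"
  by (auto simp: is_lozenge_def)

lemma tilings_empty: "tilings {} = {{}}"
proof -
  have "T = {}" if "T \<in> tilings {}" for T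
    using tilingsD(1,3)[OF that] is_lozenge_nonempty by blast
  moreover have "{} \<in> tilings {}" by (rule tilingsI) auto
  ultimately show ?thesis by blast
qed

lemma M_empty [simp]: "M {} = 1"
  by (simp add: M_eq_card_tilings tilings_empty)

lemma M_forced:
  assumes forced: "\<And>T. T \<in> tilings R \<Longrightarrow> P \<subseteq> T"
    and P: "\<And>L. L \<in> P \<Longrightarrow> is_lozenge L" "\<And>L L'. \<lbrakk>L \<in> P; L' \<in> P; L \<noteq> L'\<rbrakk> \<Longrightarrow> L \<inter> L' = {}"
      "\<Union>P \<subseteq> R"
  shows "M R = M (R - \<Union>P)"
proof -
  have "bij_betw (\<lambda>T. T - P) (tilings R) (tilings (R - \<Union>P))"
  proof (rule bij_betw_byWitness[where f' = "\<lambda>T. T \<union> P"])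
    show "\<forall>T\<in>tilings R. T - P \<union> P = T" using forced by blast
    \<comment> \<open>A lozenge in both \<open>T\<close> and \<open>P\<close> would lie inside and
      outside of \<open>\<Union>P\<close> and hence be empty.\<close>
    show "\<forall>T\<in>tilings (R - \<Union>P). T \<union> P - P = T"
    proof safe
      fix T L assume "T \<in> tilings (R - \<Union>P)" "L \<in> T" "L \<in> P"
      then have "L \<subseteq> R - \<Union>P" "L \<subseteq> \<Union>P" "L \<noteq> {}"
        using tilingsD(3) P(1) is_lozenge_nonempty by blast+
      then show False by blast
    qed
    show "(\<lambda>T. T - P) ` tilings R \<subseteq> tilings (R - \<Union>P)"
    proof safe
      fix T assume T: "T \<in> tilings R"
      show "T - P \<in> tilings (R - \<Union>P)"
      proof (rule tilingsI)
        show "\<Union>(T - P) = R - \<Union>P"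
          using tilingsD[OF T] forced[OF T] by blast
      qed (use tilingsD[OF T] in blast)+
    qed
    show "(\<lambda>T. T \<union> P) ` tilings (R - \<Union>P) \<subseteq> tilings R"
    proof safe
      fix T assume T: "T \<in> tilings (R - \<Union>P)"
      show "T \<union> P \<in> tilings R"
      proof (rule tilingsI)
        show "\<Union>(T \<union> P) = R"
          using tilingsD(3)[OF T] P(3) by blast
        fix L L' assume "L \<in> T \<union> P" "L' \<in> T \<union> P" "L \<noteq> L'"
        then show "L \<inter> L' = {}"
          using tilingsD(2)[OF T] tilingsD(3)[OF T] P(2) by blast
      qed (use tilingsD(1)[OF T] P(1) in blast)
    qed
  qed
  then show ?thesis by (simp add: M_eq_card_tilings bij_betw_same_card)
qed

lemma M_forced_lozenge:
  assumes "t \<in> R" "u \<in> R" "is_lozenge {t, u}"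
    and "\<And>v. is_lozenge {t, v} \<Longrightarrow> v \<in> R \<Longrightarrow> v = u"
  shows "M R = M (R - {t, u})"
proof -
  have "{{t, u}} \<subseteq> T" if T: "T \<in> tilings R" for T
  proof -
    obtain L where L: "L \<in> T" "t \<in> L" using tilingsD(3)[OF T] assms(1) by blast
    then obtain v where v: "L = {t, v}"
      using tilingsD(1)[OF T] unfolding is_lozenge_def by blast
    have "v = u" using L v assms(4)[of v] tilingsD(1,3)[OF T] by blast
    then show ?thesis using L v by simp
  qed
  from M_forced[of R "{{t, u}}", OF this] show ?thesis using assms(1-3) by auto
qed

lemma M_isolated:
  assumes "t \<in> R" and "\<And>v. is_lozenge {t, v} \<Longrightarrow> v \<notin> R"
  shows "M R = 0"
proof -
  have False if T: "T \<in> tilings R" for T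
  proof -
    obtain L where L: "L \<in> T" "t \<in> L" using tilingsD(3)[OF T] assms(1) by blast
    then obtain v where v: "L = {t, v}"
      using tilingsD(1)[OF T] unfolding is_lozenge_def by blast
    then show False using L v assms(2)[of v] tilingsD(1,3)[OF T] by blast
  qed
  then have "tilings R = {}" by blast
  then show ?thesis by (simp add: M_eq_card_tilings)
qed

section \<open>Cutting and gluing tilings\<close>

fun triangle_row :: "unit_triangle \<Rightarrow> int" where
  "triangle_row (Up i j) = j"
| "triangle_row (Down i j) = j"

definition upper :: "int \<Rightarrow> region \<Rightarrow> region" where
  "upper j R = {t \<in> R. j \<le> triangle_row t}"

definition lower :: "int \<Rightarrow> region \<Rightarrow> region" where
  "lower j R = {t \<in> R. triangle_row t < j}"

definition crossing :: "int \<Rightarrow> region \<Rightarrow> int set" where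
  "crossing j R = {i. Up i j \<in> R \<and> Down i (j - 1) \<in> R}"

definition ups :: "int \<Rightarrow> int set \<Rightarrow> region" where
  "ups j S = (\<lambda>i. Up i j) ` S"

definition downs :: "int \<Rightarrow> int set \<Rightarrow> region" where
  "downs j S = (\<lambda>i. Down i j) ` S"

definition vertical :: "int \<Rightarrow> int \<Rightarrow> unit_triangle set" where
  "vertical j i = {Up i j, Down i (j - 1)}"

text \<open>Row \<open>k\<close> is the strip between the heights \<open>k\<close> and
  \<open>k + 1\<close>. A lozenge meets two strips only if its triangles share a horizontal
  edge.\<close>

lemma lozenge_trichotomy:
  assumes "is_lozenge L"
  obtains "L \<subseteq> {t. j \<le> triangle_row t}" | "L \<subseteq> {t. triangle_row t < j}" | i where "L = vertical j i"
proof -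
  obtain i k where "L = {Up i k, Down i k} \<or> L = {Up i k, Down (i - 1) k} \<or> L = {Up i k, Down i (k - 1)}"
    using assms unfolding is_lozenge_iff by blast
  then have "(\<forall>t\<in>L. triangle_row t = k) \<or> L = vertical k i"
    by (elim disjE) (simp_all add: vertical_def)
  then have "L \<subseteq> {t. j \<le> triangle_row t} \<or> L \<subseteq> {t. triangle_row t < j} \<or> L = vertical j i"
    by (cases k j rule: linorder_cases) (auto simp: vertical_def)
  then show thesis using that by blast
qed

lemma is_lozenge_vertical: "is_lozenge (vertical j i)"
  by (auto simp: is_lozenge_iff vertical_def)

definition glue :: "int \<Rightarrow> int set \<times> unit_triangle set set \<times> unit_triangle set set \<Rightarrow> unit_triangle set set" where
  "glue j = (\<lambda>(S, T1, T2). T1 \<union> T2 \<union> vertical j ` S)"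

definition cut :: "int \<Rightarrow> unit_triangle set set \<Rightarrow> int set \<times> unit_triangle set set \<times> unit_triangle set set" where
  "cut j T = ({i. vertical j i \<in> T}, {L \<in> T. L \<subseteq> {t. j \<le> triangle_row t}}, {L \<in> T. L \<subseteq> {t. triangle_row t < j}})"

text \<open>A dependent sum, since the halves to be tiled depend on \<open>S\<close>: each crossing
  lozenge takes one triangle from either side of the line.\<close>

definition cut_tilings :: "int \<Rightarrow> region \<Rightarrow> (int set \<times> unit_triangle set set \<times> unit_triangle set set) set" where
  "cut_tilings j R = (SIGMA S:Pow (crossing j R).
     tilings (upper j R - ups j S) \<times> tilings (lower j R - downs (j - 1) S))"

lemma glue_cut: "T \<in> tilings R \<Longrightarrow> glue j (cut j T) = T"
proof -
  assume T: "T \<in> tilings R"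
  have "L \<subseteq> {t. j \<le> triangle_row t} \<or> L \<subseteq> {t. triangle_row t < j} \<or> L \<in> vertical j ` {i. vertical j i \<in> T}"
    if "L \<in> T" for L
    using tilingsD(1)[OF T that] by (cases rule: lozenge_trichotomy[of _ j]) (use that in auto)
  then show ?thesis unfolding glue_def cut_def by blast
qed

lemma cut_in_cut_tilings:
  assumes T: "T \<in> tilings R"
  shows "cut j T \<in> cut_tilings j R"
proof -
  note TD = tilingsD[OF T]
  let ?S = "{i. vertical j i \<in> T}"
  have "?S \<subseteq> crossing j R"
    using TD(3) by (auto simp: crossing_def vertical_def)
  moreover have "{L \<in> T. L \<subseteq> {t. j \<le> triangle_row t}} \<in> tilings (upper j R - ups j ?S)"
  proof (rule tilingsI)
    show "\<Union>{L \<in> T. L \<subseteq> {t. j \<le> triangle_row t}} = upper j R - ups j ?S" (is "?l = ?r")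
    proof (intro equalityI subsetI)
      fix t assume "t \<in> ?l"
      then obtain L where L: "L \<in> T" "L \<subseteq> {t. j \<le> triangle_row t}" "t \<in> L" by blast
      \<comment> \<open>A lozenge of \<open>T\<close> containing \<open>Up i j\<close> meets
        \<open>vertical j i\<close> and so coincides with it, but the latter sticks out below the
        line.\<close>
      have False if "t = Up i j" "vertical j i \<in> T" for i
      proof -
        have "L \<inter> vertical j i \<noteq> {}" using L that by (auto simp: vertical_def)
        then have "L = vertical j i" using TD(2) L that by blast
        then show False using L by (auto simp: vertical_def)
      qed
      then show "t \<in> ?r" using L TD(3) by (auto simp: upper_def ups_def)
    next
      fix t assume t: "t \<in> ?r"
      then obtain L where L: "L \<in> T" "t \<in> L" using TD(3) by (auto simp: upper_def)
      have "L \<subseteq> {t. j \<le> triangle_row t}"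
        using TD(1)[OF L(1)]
      proof (cases rule: lozenge_trichotomy[of _ j])
        case (3 i)
        then show ?thesis using t L by (auto simp: upper_def ups_def vertical_def)
      qed (use t L in \<open>auto simp: upper_def\<close>)
      then show "t \<in> ?l" using L by blast
    qed
  qed (use TD in auto)
  moreover have "{L \<in> T. L \<subseteq> {t. triangle_row t < j}} \<in> tilings (lower j R - downs (j - 1) ?S)"
  proof (rule tilingsI)
    show "\<Union>{L \<in> T. L \<subseteq> {t. triangle_row t < j}} = lower j R - downs (j - 1) ?S" (is "?l = ?r")
    proof (intro equalityI subsetI)
      fix t assume "t \<in> ?l"
      then obtain L where L: "L \<in> T" "L \<subseteq> {t. triangle_row t < j}" "t \<in> L" by blast
      have False if "t = Down i (j - 1)" "vertical j i \<in> T" for i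
      proof -
        have "L \<inter> vertical j i \<noteq> {}" using L that by (auto simp: vertical_def)
        then have "L = vertical j i" using TD(2) L that by blast
        then show False using L by (auto simp: vertical_def)
      qed
      then show "t \<in> ?r" using L TD(3) by (auto simp: lower_def downs_def)
    next
      fix t assume t: "t \<in> ?r"
      then obtain L where L: "L \<in> T" "t \<in> L" using TD(3) by (auto simp: lower_def)
      have "L \<subseteq> {t. triangle_row t < j}"
        using TD(1)[OF L(1)]
      proof (cases rule: lozenge_trichotomy[of _ j])
        case (3 i)
        then show ?thesis using t L by (auto simp: lower_def downs_def vertical_def)
      qed (use t L in \<open>auto simp: lower_def\<close>)
      then show "t \<in> ?l" using L by blast
    qed
  qed (use TD in auto)
  ultimately show ?thesis by (simp add: cut_def cut_tilings_def)
qed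

lemma glue_in_tilings:
  assumes "c \<in> cut_tilings j R"
  shows "glue j c \<in> tilings R"
proof -
  obtain S T1 T2 where c: "c = (S, T1, T2)" and S: "S \<subseteq> crossing j R"
    and T1: "T1 \<in> tilings (upper j R - ups j S)" and T2: "T2 \<in> tilings (lower j R - downs (j - 1) S)"
    using assms by (auto simp: cut_tilings_def)
  note D1 = tilingsD[OF T1] and D2 = tilingsD[OF T2]
  have sub1: "L \<subseteq> upper j R - ups j S" if "L \<in> T1" for L using D1(3) that by blast
  have sub2: "L \<subseteq> lower j R - downs (j - 1) S" if "L \<in> T2" for L using D2(3) that by blast
  have V1: "(upper j R - ups j S) \<inter> vertical j i = {}" if "i \<in> S" for i
    using that by (auto simp: upper_def ups_def vertical_def)
  have V2: "(lower j R - downs (j - 1) S) \<inter> vertical j i = {}" if "i \<in> S" for i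
    using that by (auto simp: lower_def downs_def vertical_def)
  have V3: "(upper j R - ups j S) \<inter> (lower j R - downs (j - 1) S) = {}"
    by (auto simp: upper_def lower_def)
  have "T1 \<union> T2 \<union> vertical j ` S \<in> tilings R"
  proof (rule tilingsI)
    fix L assume "L \<in> T1 \<union> T2 \<union> vertical j ` S"
    then show "is_lozenge L" using D1(1) D2(1) is_lozenge_vertical by blast
  next
    fix L L' assume L: "L \<in> T1 \<union> T2 \<union> vertical j ` S" "L' \<in> T1 \<union> T2 \<union> vertical j ` S" "L \<noteq> L'"
    have VV: "vertical j i \<inter> vertical j i' = {}" if "vertical j i \<noteq> vertical j i'" for i i'
      using that by (auto simp: vertical_def)
    consider "L \<in> T1" | "L \<in> T2" | "L \<in> vertical j ` S" using L(1) by blast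
    then show "L \<inter> L' = {}"
    proof cases
      case 1
      then show ?thesis using L D1(2) sub1[OF 1] sub2[of L'] V1 V3 by blast
    next
      case 2
      then show ?thesis using L D2(2) sub1[of L'] sub2[OF 2] V2 V3 by blast
    next
      case 3
      then obtain i where i: "i \<in> S" "L = vertical j i" by blast
      consider "L' \<in> T1" | "L' \<in> T2" | "L' \<in> vertical j ` S" using L(2) by blast
      then show ?thesis
        using V1[OF i(1)] V2[OF i(1)] sub1[of L'] sub2[of L'] VV L(3) i(2) by cases blast+
    qed
  next
    have "\<Union>(vertical j ` S) = ups j S \<union> downs (j - 1) S"
      by (auto simp: vertical_def ups_def downs_def)
    moreover have "ups j S \<subseteq> upper j R" "downs (j - 1) S \<subseteq> lower j R"
      using S by (auto simp: crossing_def upper_def lower_def ups_def downs_def)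
    moreover have "upper j R \<union> lower j R = R"
      by (auto simp: upper_def lower_def)
    ultimately show "\<Union>(T1 \<union> T2 \<union> vertical j ` S) = R"
      using D1(3) D2(3) by auto
  qed
  then show ?thesis by (simp add: c glue_def)
qed

text \<open>Lozenges above the line, below it and across it exclude each other because lozenges are
  nonempty, so the three parts can be recovered from their union.\<close>

lemma cut_glue:
  assumes "c \<in> cut_tilings j R"
  shows "cut j (glue j c) = c"
proof -
  obtain S T1 T2 where c: "c = (S, T1, T2)" and S: "S \<subseteq> crossing j R"
    and T1: "T1 \<in> tilings (upper j R - ups j S)" and T2: "T2 \<in> tilings (lower j R - downs (j - 1) S)"
    using assms by (auto simp: cut_tilings_def)
  note D1 = tilingsD[OF T1] and D2 = tilingsD[OF T2]
  have sub1: "L \<subseteq> {t. j \<le> triangle_row t}" "L \<noteq> {}" if "L \<in> T1" for L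
    using D1(1,3) that is_lozenge_nonempty by (auto simp: upper_def)
  have sub2: "L \<subseteq> {t. triangle_row t < j}" "L \<noteq> {}" if "L \<in> T2" for L
    using D2(1,3) that is_lozenge_nonempty by (auto simp: lower_def)
  have V: "\<not> vertical j i \<subseteq> {t. j \<le> triangle_row t}" "\<not> vertical j i \<subseteq> {t. triangle_row t < j}" for i
    by (auto simp: vertical_def)
  have disj: "L = {}" if "L \<subseteq> {t. j \<le> triangle_row t}" "L \<subseteq> {t. triangle_row t < j}" for L
    using that by fastforce
  have not2: "\<not> L \<subseteq> {t. j \<le> triangle_row t}" if "L \<in> T2" for L using sub2[OF that] disj by blast
  have not1: "\<not> L \<subseteq> {t. triangle_row t < j}" if "L \<in> T1" for L using sub1[OF that] disj by blast
  have inj: "i = i'" if "vertical j i = vertical j i'" for i i'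
    using that by (auto simp: vertical_def doubleton_eq_iff)
  have "vertical j i \<notin> T1" "vertical j i \<notin> T2" for i
    using sub1(1)[of "vertical j i"] sub2(1)[of "vertical j i"] V[of i] by auto
  then have "{i. vertical j i \<in> T1 \<union> T2 \<union> vertical j ` S} = S"
    using inj by auto
  moreover have "{L \<in> T1 \<union> T2 \<union> vertical j ` S. L \<subseteq> {t. j \<le> triangle_row t}} = T1"
    using sub1(1) V(1) not2 by auto
  moreover have "{L \<in> T1 \<union> T2 \<union> vertical j ` S. L \<subseteq> {t. triangle_row t < j}} = T2"
    using sub2(1) V(2) not1 by auto
  ultimately show ?thesis by (simp add: c cut_def glue_def)
qed

lemma bij_betw_glue: "bij_betw (glue j) (cut_tilings j R) (tilings R)"
  by (rule bij_betw_byWitness[where f' = "cut j"])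
    (auto simp: cut_glue glue_cut glue_in_tilings cut_in_cut_tilings)

lemma finite_crossing: "finite R \<Longrightarrow> finite (crossing j R)"
  by (rule finite_imageD[of "\<lambda>i. Up i j"], rule finite_subset[of _ R])
    (auto simp: crossing_def inj_on_def)

lemma finite_upper [simp]: "finite R \<Longrightarrow> finite (upper j R)"
  by (simp add: upper_def)

lemma finite_lower [simp]: "finite R \<Longrightarrow> finite (lower j R)"
  by (simp add: lower_def)

theorem M_split:
  assumes "finite R"
  shows "M R = (\<Sum>S\<in>Pow (crossing j R). M (upper j R - ups j S) * M (lower j R - downs (j - 1) S))"
proof -
  have "M R = card (cut_tilings j R)"
    using bij_betw_same_card[OF bij_betw_glue] by (simp add: M_eq_card_tilings)
  then show ?thesis
    using assms by (simp add: cut_tilings_def M_eq_card_tilings finite_tilings finite_crossing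
        card_cartesian_product)
qed

section \<open>Tilings and the rotation by 180 degrees\<close>

lemma rotate_triangle_involution [simp]: "rotate_triangle d (rotate_triangle d t) = t"
  by (cases d; cases t) auto

lemma inj_rotate_triangle: "inj (rotate_triangle d)"
  by (metis injI rotate_triangle_involution)

lemma is_lozenge_rotate: "is_lozenge L \<Longrightarrow> is_lozenge (rotate_triangle d ` L)"
proof -
  assume "is_lozenge L"
  then obtain s t where st: "L = {s, t}" "s \<noteq> t" "card (vertices s \<inter> vertices t) = 2"
    by (auto simp: is_lozenge_def)
  have inj: "inj (rotate_point d)"
    by (cases d) (auto simp: inj_on_def)
  have "vertices (rotate_triangle d s) \<inter> vertices (rotate_triangle d t)
      = rotate_point d ` (vertices s \<inter> vertices t)"
    by (simp add: vertices_rotate_triangle image_Int[OF inj])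
  then have "card (vertices (rotate_triangle d s) \<inter> vertices (rotate_triangle d t)) = 2"
    using st(3) inj by (simp add: card_image inj_on_subset)
  moreover have "rotate_triangle d s \<noteq> rotate_triangle d t"
    using st(2) by (metis rotate_triangle_involution)
  ultimately show ?thesis using st(1) by (auto simp: is_lozenge_def)
qed

lemma rotate_tiling_involution [simp]:
  "(`) (rotate_triangle d) ` (`) (rotate_triangle d) ` T = T"
  by (simp add: image_image)

lemma rotate_in_tilings:
  assumes T: "T \<in> tilings R"
  shows "(`) (rotate_triangle d) ` T \<in> tilings (rotate_triangle d ` R)"
proof (rule tilingsI)
  note TD = tilingsD[OF T]
  show "\<Union>((`) (rotate_triangle d) ` T) = rotate_triangle d ` R"
    using TD(3) by blast
  fix L assume "L \<in> (`) (rotate_triangle d) ` T"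
  then show "is_lozenge L" using TD(1) is_lozenge_rotate by blast
  fix L' assume "L' \<in> (`) (rotate_triangle d) ` T" "L \<noteq> L'"
  with \<open>L \<in> _\<close> obtain K K' where "K \<in> T" "K' \<in> T" "K \<noteq> K'"
      "L = rotate_triangle d ` K" "L' = rotate_triangle d ` K'" by blast
  then show "L \<inter> L' = {}"
    using TD(2)[of K K'] image_Int[OF inj_rotate_triangle, of d K K'] by auto
qed

lemma M_rotate: "M (rotate_triangle d ` R) = M R"
proof -
  have "bij_betw ((`) ((`) (rotate_triangle d))) (tilings R) (tilings (rotate_triangle d ` R))"
  proof (rule bij_betw_byWitness[where f' = "(`) ((`) (rotate_triangle d))"])
    have "rotate_triangle d ` rotate_triangle d ` R = R" by (simp add: image_image)
    then show "(`) ((`) (rotate_triangle d)) ` tilings (rotate_triangle d ` R) \<subseteq> tilings R"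
      using rotate_in_tilings[of _ "rotate_triangle d ` R" d] by (metis image_subsetI)
  qed (simp_all add: rotate_in_tilings image_subset_iff)
  then show ?thesis by (simp add: M_eq_card_tilings bij_betw_same_card)
qed

text \<open>The crossing lozenge at \<open>i\<close> sits on the segment from \<open>i\<close> to
  \<open>i + 1\<close>, whose image under the rotation begins at \<open>d - 1 - i\<close>. The
  doubled centre \<open>(d, 2 * j)\<close> expresses that the centre lies on the line at height
  \<open>j\<close>.\<close>

lemma rotate_vertical:
  "rotate_triangle (d, 2 * j) ` vertical j i = vertical j (d - 1 - i)"
  by (auto simp: vertical_def insert_commute)

lemma lower_eq_rotate_upper:
  assumes "rotate_triangle (d, 2 * j) ` R = R"
  shows "lower j R - downs (j - 1) S
       = rotate_triangle (d, 2 * j) ` (upper j R - ups j ((\<lambda>i. d - 1 - i) ` S))" (is "?l = ?\<rho> ` ?r")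
proof -
  have R: "?\<rho> t \<in> R \<longleftrightarrow> t \<in> R" for t
    using assms by (metis image_eqI rotate_triangle_involution)
  have triangle_row: "triangle_row (?\<rho> t) = 2 * j - 1 - triangle_row t" for t by (cases t) auto
  have mem: "t \<in> ?l \<longleftrightarrow> ?\<rho> t \<in> ?r" for t
    by (cases t) (auto simp: lower_def upper_def R ups_def downs_def image_iff
        simp del: rotate_triangle.simps, auto simp: triangle_row)
  show ?thesis
  proof (intro equalityI subsetI)
    fix t assume "t \<in> ?l"
    then have "?\<rho> t \<in> ?r" by (rule mem[THEN iffD1])
    then have "?\<rho> (?\<rho> t) \<in> ?\<rho> ` ?r" by (rule imageI)
    then show "t \<in> ?\<rho> ` ?r" by (simp only: rotate_triangle_involution)
  next
    fix t assume "t \<in> ?\<rho> ` ?r"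
    then obtain u where u: "u \<in> ?r" "t = ?\<rho> u" by (rule imageE)
    have "?\<rho> t \<in> ?r" unfolding u(2) rotate_triangle_involution by (rule u(1))
    then show "t \<in> ?l" by (rule mem[THEN iffD2])
  qed
qed

theorem M_split_symmetric:
  assumes "finite R" and "rotate_triangle (d, 2 * j) ` R = R"
  shows "M R = (\<Sum>S\<in>Pow (crossing j R).
     M (upper j R - ups j S) * M (upper j R - ups j ((\<lambda>i. d - 1 - i) ` S)))"
  using M_split[OF assms(1), of j] by (simp add: lower_eq_rotate_upper[OF assms(2)] M_rotate)

lemma crossing_rotate:
  assumes "rotate_triangle (d, 2 * j) ` R = R" and "i \<in> crossing j R"
  shows "d - 1 - i \<in> crossing j R"
proof -
  have "rotate_triangle (d, 2 * j) (Up i j) \<in> R" "rotate_triangle (d, 2 * j) (Down i (j - 1)) \<in> R"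
    using assms by (auto simp: crossing_def simp del: rotate_triangle.simps)
  then show ?thesis by (simp add: crossing_def algebra_simps)
qed

text \<open>The rotation transported to cut tilings: it exchanges the halves, and
  \<open>glue\<close> becomes equivariant.\<close>

definition rotate_cut ::
  "int \<times> int \<Rightarrow> int set \<times> unit_triangle set set \<times> unit_triangle set set
     \<Rightarrow> int set \<times> unit_triangle set set \<times> unit_triangle set set" where
  "rotate_cut d = (\<lambda>(S, T1, T2). ((\<lambda>i. fst d - 1 - i) ` S,
     (`) (rotate_triangle d) ` T2, (`) (rotate_triangle d) ` T1))"

lemma glue_rotate_cut:
  "glue j (rotate_cut (d, 2 * j) c) = (`) (rotate_triangle (d, 2 * j)) ` glue j c"
proof -
  have "(`) (rotate_triangle (d, 2 * j)) ` vertical j ` S = vertical j ` (\<lambda>i. d - 1 - i) ` S" for S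
    by (simp add: image_image rotate_vertical)
  then show ?thesis by (cases c) (simp add: glue_def rotate_cut_def image_Un Un_commute)
qed

lemma rotate_cut_in_cut_tilings:
  assumes sym: "rotate_triangle (d, 2 * j) ` R = R" and "c \<in> cut_tilings j R"
  shows "rotate_cut (d, 2 * j) c \<in> cut_tilings j R"
proof -
  let ?\<rho> = "rotate_triangle (d, 2 * j)" and ?\<sigma> = "\<lambda>i::int. d - 1 - i"
  obtain S T1 T2 where c: "c = (S, T1, T2)" and S: "S \<subseteq> crossing j R"
    and T1: "T1 \<in> tilings (upper j R - ups j S)" and T2: "T2 \<in> tilings (lower j R - downs (j - 1) S)"
    using assms by (auto simp: cut_tilings_def)
  have "?\<sigma> ` S \<subseteq> crossing j R" using S crossing_rotate[OF sym] by blast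
  moreover have "(`) ?\<rho> ` T2 \<in> tilings (upper j R - ups j (?\<sigma> ` S))"
    using rotate_in_tilings[OF T2, of "(d, 2 * j)"]
    unfolding lower_eq_rotate_upper[OF sym] image_image rotate_triangle_involution by simp
  moreover have "(`) ?\<rho> ` T1 \<in> tilings (lower j R - downs (j - 1) (?\<sigma> ` S))"
    using rotate_in_tilings[OF T1, of "(d, 2 * j)"]
    unfolding lower_eq_rotate_upper[OF sym] by (simp add: image_image)
  ultimately show ?thesis by (simp add: c rotate_cut_def cut_tilings_def)
qed

theorem M_odot_split:
  assumes "finite R" and sym: "rotate_triangle (d, 2 * j) ` R = R"
  shows "M_odot (d, 2 * j) R = (\<Sum>S | S \<subseteq> crossing j R \<and> (\<lambda>i. d - 1 - i) ` S = S.
     M (upper j R - ups j S))"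
proof -
  let ?\<rho> = "rotate_triangle (d, 2 * j)" and ?\<sigma> = "\<lambda>i::int. d - 1 - i"
  let ?A = "{S. S \<subseteq> crossing j R \<and> ?\<sigma> ` S = S}"
  let ?C = "{c \<in> cut_tilings j R. rotate_cut (d, 2 * j) c = c}"
  have inj: "inj_on (glue j) (cut_tilings j R)" and img: "glue j ` cut_tilings j R = tilings R"
    using bij_betw_glue by (auto simp: bij_betw_def)
  have inv: "(`) ?\<rho> ` glue j c = glue j c \<longleftrightarrow> rotate_cut (d, 2 * j) c = c"
    if "c \<in> cut_tilings j R" for c
    unfolding glue_rotate_cut[symmetric]
    using inj_on_eq_iff[OF inj rotate_cut_in_cut_tilings[OF sym that] that] .
  have "{T. is_tiling R T \<and> (`) ?\<rho> ` T = T} = {T \<in> glue j ` cut_tilings j R. (`) ?\<rho> ` T = T}"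
    unfolding img by (auto simp: tilings_def)
  also have "\<dots> = glue j ` ?C" using inv by blast
  finally have "M_odot (d, 2 * j) R = card (glue j ` ?C)"
    by (simp add: M_odot_def)
  also have "\<dots> = card ?C"
    using inj by (intro card_image) (auto intro: inj_on_subset)
  \<comment> \<open>In a fixed triple the lower tiling is the rotated upper one, so a self-mirrored
    \<open>S\<close> and the upper tiling determine it.\<close>
  also have "?C = (\<lambda>(S, T). (S, T, (`) ?\<rho> ` T)) ` (SIGMA S:?A. tilings (upper j R - ups j S))"
    (is "_ = ?f ` ?D")
  proof (intro equalityI subsetI)
    fix c assume "c \<in> ?C"
    then obtain S T1 T2 where c: "c = (S, T1, T2)" "S \<subseteq> crossing j R"
       "T1 \<in> tilings (upper j R - ups j S)" "?\<sigma> ` S = S" "(`) ?\<rho> ` T1 = T2"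
      by (auto simp: cut_tilings_def rotate_cut_def)
    then show "c \<in> ?f ` ?D" by (intro image_eqI[of _ _ "(S, T1)"]) auto
  next
    fix c assume "c \<in> ?f ` ?D"
    then obtain S T where c: "c = (S, T, (`) ?\<rho> ` T)" "S \<subseteq> crossing j R"
      "?\<sigma> ` S = S" "T \<in> tilings (upper j R - ups j S)" by auto
    have "(`) ?\<rho> ` T \<in> tilings (lower j R - downs (j - 1) S)"
      using rotate_in_tilings[OF c(4), of "(d, 2 * j)"] c(3)
      unfolding lower_eq_rotate_upper[OF sym] by simp
    then show "c \<in> ?C" using c by (simp add: cut_tilings_def rotate_cut_def)
  qed
  also have "card (?f ` ?D) = card ?D"
    by (rule card_image) (auto simp: inj_on_def)
  also have "\<dots> = (\<Sum>S\<in>?A. card (tilings (upper j R - ups j S)))"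
    using assms(1) by (intro card_SigmaI) (auto simp: finite_tilings finite_crossing)
  finally show ?thesis by (simp add: M_eq_card_tilings)
qed

section \<open>Forced lozenges and rows of triangles\<close>

lemma is_lozenge_Up: "is_lozenge {Up i j, v} \<longleftrightarrow> v \<in> {Down i j, Down (i - 1) j, Down i (j - 1)}"
  by (auto simp: is_lozenge_iff doubleton_eq_iff)

lemma is_lozenge_Down: "is_lozenge {Down i j, v} \<longleftrightarrow> v \<in> {Up i j, Up (i + 1) j, Up i (j + 1)}"
proof (cases v)
  case (Up k l)
  have "is_lozenge {Down i j, v} \<longleftrightarrow> is_lozenge {v, Down i j}" by (simp add: insert_commute)
  then show ?thesis unfolding Up is_lozenge_Up by auto
next
  case (Down k l)
  then show ?thesis by (auto simp: is_lozenge_iff doubleton_eq_iff)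
qed

text \<open>The triangles \<open>Down i k\<close> in \<open>W\<close> can only be matched upwards:
  in row \<open>j\<close> both neighbours in the row are missing, and in higher rows these are
  already covered by the lozenges forced one row below. The forcing thus propagates by induction on
  the height.\<close>

lemma M_forced_triangles:
  assumes in_R: "\<And>i k. (i, k) \<in> W \<Longrightarrow> j \<le> k \<and> Down i k \<in> R \<and> Up i (k + 1) \<in> R"
    and base: "\<And>i. (i, j) \<in> W \<Longrightarrow> Up i j \<notin> R \<and> Up (i + 1) j \<notin> R"
    and step: "\<And>i k. (i, k) \<in> W \<Longrightarrow> j < k \<Longrightarrow> (i, k - 1) \<in> W \<and> (i + 1, k - 1) \<in> W"
  shows "M R = M (R - (\<Union>(i, k)\<in>W. {Down i k, Up i (k + 1)}))"
proof -
  let ?P = "(\<lambda>(i, k). {Down i k, Up i (k + 1)}) ` W"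
  have "?P \<subseteq> T" if T: "T \<in> tilings R" for T
  proof -
    note TD = tilingsD[OF T]
    have "(i, j + int n) \<in> W \<longrightarrow> {Down i (j + int n), Up i (j + int n + 1)} \<in> T" for i n
    proof (induction n arbitrary: i)
      case 0
      show ?case
      proof
        assume W: "(i, j + int 0) \<in> W"
        then obtain L where L: "L \<in> T" "Down i j \<in> L" using in_R[of i j] TD(3) by auto
        then obtain v where v: "L = {Down i j, v}"
          using TD(1) unfolding is_lozenge_def by blast
        have "v = Up i (j + 1)"
          using base[of i] W L v TD(1)[OF L(1)] TD(3) by (auto simp: is_lozenge_Down)
        then show "{Down i (j + int 0), Up i (j + int 0 + 1)} \<in> T" using L v by simp
      qed
    next
      case (Suc n)
      define k where "k = j + int (Suc n)"
      have k: "k - 1 = j + int n" by (simp add: k_def)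
      have "{Down i k, Up i (k + 1)} \<in> T" if W: "(i, k) \<in> W"
      proof -
        have W': "(i, k - 1) \<in> W" "(i + 1, k - 1) \<in> W" using step[OF W] by (auto simp: k_def)
        have IH: "{Down i (k - 1), Up i k} \<in> T" "{Down (i + 1) (k - 1), Up (i + 1) k} \<in> T"
          using Suc[of i] Suc[of "i + 1"] W' unfolding k[symmetric] by auto
        obtain L where L: "L \<in> T" "Down i k \<in> L" using in_R[OF W] TD(3) by auto
        then obtain v where v: "L = {Down i k, v}"
          using TD(1) unfolding is_lozenge_def by blast
        have "v \<noteq> Up i k" using TD(2)[OF IH(1) L(1)] v by (auto simp: doubleton_eq_iff)
        moreover have "v \<noteq> Up (i + 1) k" using TD(2)[OF IH(2) L(1)] v by (auto simp: doubleton_eq_iff)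
        ultimately have "v = Up i (k + 1)" using v TD(1)[OF L(1)] by (auto simp: is_lozenge_Down)
        then show ?thesis using L v by simp
      qed
      then show ?case unfolding k_def by blast
    qed
    moreover have "\<exists>n. k = j + int n" if "(i, k) \<in> W" for i k
      using in_R[OF that] zle_iff_zadd by blast
    ultimately show ?thesis by fastforce
  qed
  then have "M R = M (R - \<Union>?P)"
  proof (rule M_forced)
    fix L assume "L \<in> ?P"
    then show "is_lozenge L" by (auto simp: is_lozenge_Down)
    fix L' assume "L' \<in> ?P" "L \<noteq> L'"
    with \<open>L \<in> ?P\<close> show "L \<inter> L' = {}" by (auto simp: doubleton_eq_iff)
  next
    show "\<Union>?P \<subseteq> R" using in_R by auto
  qed
  then show ?thesis by (simp add: case_prod_unfold)
qed

text \<open>A row swept from left to right has one of two shapes, according to the orientation of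
  the first position still to be treated. \<open>S\<close> and \<open>S'\<close> are the dents on
  its lower and upper side.\<close>

definition row_from_up :: "int \<Rightarrow> int \<Rightarrow> int \<Rightarrow> int set \<Rightarrow> int set \<Rightarrow> region" where
  "row_from_up j p N S S' = ups j ({p..<N} - S) \<union> downs j ({p..<N - 1} - S')"

definition row_from_down :: "int \<Rightarrow> int \<Rightarrow> int \<Rightarrow> int set \<Rightarrow> int set \<Rightarrow> region" where
  "row_from_down j p N S S' = ups j ({p + 1..<N} - S) \<union> downs j ({p..<N - 1} - S')"

lemma Up_in_ups [simp]: "Up i k \<in> ups j S \<longleftrightarrow> k = j \<and> i \<in> S"
  and Down_in_ups [simp]: "Down i k \<notin> ups j S"
  and Up_in_downs [simp]: "Up i k \<notin> downs j S"
  and Down_in_downs [simp]: "Down i k \<in> downs j S \<longleftrightarrow> k = j \<and> i \<in> S"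
  by (auto simp: ups_def downs_def)

lemma region_eqI:
  "(\<And>i k. Up i k \<in> R \<longleftrightarrow> Up i k \<in> R') \<Longrightarrow> (\<And>i k. Down i k \<in> R \<longleftrightarrow> Down i k \<in> R') \<Longrightarrow> R = R'"
  by (metis subsetI subset_antisym unit_triangle.exhaust)

text \<open>Nothing is left of the first triangle, so only its right-hand neighbour can be its
  partner.\<close>

lemma M_row_from_up:
  assumes "p < N" "p \<notin> S"
  shows "M (row_from_up j p N S S')
    = (if p < N - 1 \<and> p \<notin> S' then M (row_from_up j (p + 1) N S S') else 0)"
proof (cases "p < N - 1 \<and> p \<notin> S'")
  case True
  let ?R = "row_from_up j p N S S'"
  have "M ?R = M (?R - {Up p j, Down p j})"
    by (rule M_forced_lozenge) (use assms True in \<open>auto simp: row_from_up_def is_lozenge_Up\<close>)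
  also have "?R - {Up p j, Down p j} = row_from_up j (p + 1) N S S'"
    by (rule region_eqI) (auto simp: row_from_up_def)
  finally show ?thesis using True by simp
next
  case False
  have "M (row_from_up j p N S S') = 0"
    by (rule M_isolated[of "Up p j"]) (use assms False in \<open>auto simp: row_from_up_def is_lozenge_Up\<close>)
  then show ?thesis using False by auto
qed

lemma M_row_from_down:
  assumes "p < N - 1" "p \<notin> S'"
  shows "M (row_from_down j p N S S')
    = (if p + 1 \<notin> S then M (row_from_down j (p + 1) N S S') else 0)"
proof (cases "p + 1 \<in> S")
  case False
  let ?R = "row_from_down j p N S S'"
  have "M ?R = M (?R - {Down p j, Up (p + 1) j})"
    by (rule M_forced_lozenge) (use assms False in \<open>auto simp: row_from_down_def is_lozenge_Down\<close>)
  also have "?R - {Down p j, Up (p + 1) j} = row_from_down j (p + 1) N S S'"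
    by (rule region_eqI) (auto simp: row_from_down_def)
  finally show ?thesis using False by simp
next
  case True
  have "M (row_from_down j p N S S') = 0"
    by (rule M_isolated[of "Down p j"])
      (use assms True in \<open>auto simp: row_from_down_def is_lozenge_Down\<close>)
  then show ?thesis using True by simp
qed

lemma strict_sorted_hd_min:
  "sorted_wrt (<) xs \<Longrightarrow> p \<in> set xs \<Longrightarrow> set xs \<subseteq> {p..<q} \<Longrightarrow> \<exists>ys. xs = p # ys"
  for p q :: int
  by (cases xs) (auto simp: order.antisym)

lemma strict_sorted_tl_subset:
  "sorted_wrt (<) (p # xs) \<Longrightarrow> set (p # xs) \<subseteq> {p..<q} \<Longrightarrow> set xs \<subseteq> {p + 1..<q}" for p q :: int
  by fastforce

lemma subset_int_interval_not_min:
  fixes p q :: int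
  assumes "A \<subseteq> {p..<q}" "p \<notin> A"
  shows "A \<subseteq> {p + 1..<q}"
proof
  fix x assume "x \<in> A"
  then have "x \<noteq> p" "p \<le> x" "x < q" using assms by auto
  then show "x \<in> {p + 1..<q}" by simp
qed

text \<open>During the sweep a lower dent switches from the first shape to the second and an upper
  dent switches back. In the second shape one lower dent still waits for the upper dent that follows
  it; the entry \<open>p\<close> in front of \<open>xs\<close> represents it. The induction variable
  \<open>d\<close> counts the down-pointing positions left.\<close>

lemma M_row_interlaces:
  "sorted_wrt (<) xs \<Longrightarrow> sorted_wrt (<) t \<Longrightarrow> p = N - 1 - int d \<Longrightarrow> set t \<subseteq> {p..<N - 1} \<Longrightarrow>
    (set xs \<subseteq> {p..<N} \<longrightarrow> M (row_from_up j p N (set xs) (set t)) = of_bool (interlaces xs t)) \<and>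
    (set xs \<subseteq> {p + 1..<N} \<longrightarrow> M (row_from_down j p N (set xs) (set t)) = of_bool (interlaces (p # xs) t))"
proof (induction d arbitrary: p xs t)
  case 0
  then have t: "t = []" and p: "p = N - 1" by auto
  have down: "M (row_from_down j p N S {}) = 1" for S
  proof -
    have "row_from_down j p N S {} = {}" by (auto simp: row_from_down_def p ups_def downs_def)
    then show ?thesis by simp
  qed
  have "M (row_from_up j p N (set xs) {}) = of_bool (interlaces xs [])" if xs: "set xs \<subseteq> {p..<N}"
  proof (cases xs)
    case Nil
    then show ?thesis using M_row_from_up[of p N "{}" j "{}"] p by simp
  next
    case (Cons a xs')
    then have "a = p" "xs' = []" using xs 0(1) p by (auto simp: neq_Nil_conv) (cases xs'; force)
    then have "row_from_up j p N (set xs) {} = row_from_down j p N {} {}"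
      using Cons by (auto simp: row_from_up_def row_from_down_def p ups_def)
    then show ?thesis using down \<open>xs' = []\<close> Cons by simp
  qed
  moreover have "xs = []" if "set xs \<subseteq> {p + 1..<N}" using that p by (cases xs) auto
  ultimately show ?case using down t by auto
next
  case (Suc d)
  have p: "p < N - 1" "p + 1 = N - 1 - int d" using Suc.prems by auto
  have IHu: "M (row_from_up j (p + 1) N (set xs) (set t)) = of_bool (interlaces xs t)"
    if "sorted_wrt (<) xs" "sorted_wrt (<) t" "set xs \<subseteq> {p + 1..<N}" "set t \<subseteq> {p + 1..<N - 1}" for xs t
    using Suc.IH[OF that(1,2) p(2)] that by blast
  have IHd: "M (row_from_down j (p + 1) N (set xs) (set t)) = of_bool (interlaces ((p + 1) # xs) t)"
    if "sorted_wrt (<) xs" "sorted_wrt (<) t" "set xs \<subseteq> {p + 1 + 1..<N}" "set t \<subseteq> {p + 1..<N - 1}" for xs t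
    using Suc.IH[OF that(1,2) p(2)] that by blast
  have t_tl: "set t' \<subseteq> {p + 1..<N - 1}" if "t = p # t'" for t'
    using strict_sorted_tl_subset[of p t' "N - 1"] that Suc.prems(2,4) by simp
  have t_ge: "set t \<subseteq> {p + 1..<N - 1}" if "p \<notin> set t"
    using subset_int_interval_not_min[OF Suc.prems(4) that] .
  have t_hd: "\<exists>t'. t = p # t'" if "p \<in> set t"
    using strict_sorted_hd_min[OF Suc.prems(2) that Suc.prems(4)] .
  have down: "M (row_from_down j p N (set xs) (set t)) = of_bool (interlaces (p # xs) t)"
    if ss: "sorted_wrt (<) xs" and xs: "set xs \<subseteq> {p + 1..<N}" for xs
  proof (cases "p \<in> set t")
    case True
    then obtain t' where t': "t = p # t'" using t_hd by blast
    have "row_from_down j p N (set xs) (set t) = row_from_up j (p + 1) N (set xs) (set t')"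
      by (rule region_eqI) (auto simp: row_from_down_def row_from_up_def t')
    then have "M (row_from_down j p N (set xs) (set t)) = of_bool (interlaces xs t')"
      using IHu[of xs t'] ss xs t_tl[OF t'] Suc.prems(2) t' by auto
    then show ?thesis using t' xs by (cases xs) auto
  next
    case False
    show ?thesis
    proof (cases "p + 1 \<in> set xs")
      case True
      then obtain xs' where xs': "xs = (p + 1) # xs'"
        using strict_sorted_hd_min[OF ss True xs] by blast
      have "\<not> interlaces (p # xs) t"
        using False xs' by (cases t) auto
      then show ?thesis using M_row_from_down[of p N "set t" j "set xs"] p(1) False True by simp
    next
      case s1: False
      then have "set xs \<subseteq> {p + 1 + 1..<N}"
        using subset_int_interval_not_min[OF xs] by simp
      then have "M (row_from_down j p N (set xs) (set t)) = of_bool (interlaces ((p + 1) # xs) t)"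
        using M_row_from_down[of p N "set t" j "set xs"] p(1) False s1 IHd[of xs t] ss Suc.prems(2) t_ge
        by simp
      \<comment> \<open>As \<open>p\<close> is not an upper dent, the waiting lower dent can be
        moved from \<open>p\<close> to \<open>p + 1\<close>.\<close>
      moreover have "interlaces ((p + 1) # xs) t \<longleftrightarrow> interlaces (p # xs) t"
        using False by (cases xs; cases t) auto
      ultimately show ?thesis by simp
    qed
  qed
  have up: "M (row_from_up j p N (set xs) (set t)) = of_bool (interlaces xs t)" if xs: "set xs \<subseteq> {p..<N}"
  proof (cases "p \<in> set xs")
    case True
    then obtain xs' where xs': "xs = p # xs'"
      using strict_sorted_hd_min[OF Suc.prems(1) True xs] by blast
    have xs'_sub: "sorted_wrt (<) xs'" "set xs' \<subseteq> {p + 1..<N}"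
      using strict_sorted_tl_subset[of p xs' N] Suc.prems(1) xs xs' by simp_all
    have "row_from_up j p N (set xs) (set t) = row_from_down j p N (set xs') (set t)"
      using Suc.prems(1) by (intro region_eqI) (auto simp: row_from_down_def row_from_up_def xs')
    then show ?thesis using down[OF xs'_sub] xs' by simp
  next
    case False
    then have s_ge: "set xs \<subseteq> {p + 1..<N}" using subset_int_interval_not_min[OF xs] by simp
    show ?thesis
    proof (cases "p \<in> set t")
      case True
      then obtain t' where t': "t = p # t'" using t_hd by blast
      have "\<not> interlaces xs t"
      proof (cases xs)
        case (Cons a xs')
        then have "p < a" using s_ge by auto
        then show ?thesis using Cons t' by (cases xs') auto
      qed (simp add: t')
      then show ?thesis using M_row_from_up[of p N "set xs" j "set t"] p(1) False True by simp
    next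
      case t1: False
      then show ?thesis
        using M_row_from_up[of p N "set xs" j "set t"] p(1) False IHu[of xs t] s_ge t_ge Suc.prems(1,2) by simp
    qed
  qed
  show ?case using up down Suc.prems(1) by blast
qed

lemma M_row:
  assumes "sorted_wrt (<) xs" "sorted_wrt (<) t" "set xs \<subseteq> {0..<N}" "set t \<subseteq> {0..<N - 1}" "0 < N"
  shows "M (row_from_up j 0 N (set xs) (set t)) = of_bool (interlaces xs t)"
  using M_row_interlaces[of xs t 0 N "nat (N - 1)" j] assms by auto

text \<open>Passes from sets of dents to sorted lists. The range of \<open>S\<close> captures every
  interlacing sequence, since such a sequence stays between the first and the last entry of
  \<open>xs\<close>.\<close>

lemma sum_interlaces:
  fixes f :: "int set \<Rightarrow> real"
  assumes xs: "sorted_wrt (<) xs" "set xs \<subseteq> {0..<N}"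
  shows "(\<Sum>S\<in>Pow {0..<N - 1}. f S * of_bool (interlaces xs (sorted_list_of_set S)))
       = (\<Sum>t | interlaces xs t. f (set t))"
proof -
  let ?B = "{S \<in> Pow {0..<N - 1}. interlaces xs (sorted_list_of_set S)}"
  have "(\<Sum>S\<in>Pow {0..<N - 1}. f S * of_bool (interlaces xs (sorted_list_of_set S)))
      = (\<Sum>S\<in>?B. f S)"
    by (intro sum.mono_neutral_cong_right) auto
  also have "\<dots> = (\<Sum>t | interlaces xs t. f (set t))"
  proof (rule sum.reindex_bij_witness[where j = sorted_list_of_set and i = set])
    fix t assume t: "t \<in> {t. interlaces xs t}"
    have sorted: "sorted_wrt (<) t" using interlaces_strict_sorted t xs by auto
    then show eq: "sorted_list_of_set (set t) = t"
      by (simp add: strict_sorted_iff sorted_list_of_set.idem_if_sorted_distinct)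
    have "xs \<noteq> []" using t by (cases xs) auto
    then have "hd xs \<in> set xs" "last xs \<in> set xs" by auto
    moreover have "hd xs \<le> x \<and> x < last xs" if "x \<in> set t" for x
      using interlaces_bounds[of xs t x] t xs that by auto
    ultimately have "set t \<subseteq> {0..<N - 1}" using xs(2) by fastforce
    then show "set t \<in> ?B" using t eq by auto
  next
    fix S assume "S \<in> ?B"
    then have "finite S" by (auto intro: finite_subset)
    then show "set (sorted_list_of_set S) = S" "f (set (sorted_list_of_set S)) = f S" by auto
  qed auto
  finally show ?thesis .
qed

section \<open>Splitting off the bottom row of a trapezoid\<close>

text \<open>In slanted coordinates every row starts at index 0 and is one unit shorter than the row
  below, so removing the bottom row leaves a trapezoid without any shift of the first
  coordinate.\<close>

definition trapezoid :: "int \<Rightarrow> int \<Rightarrow> nat \<Rightarrow> region" where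
  "trapezoid j N n = {t. case t of
       Up i k \<Rightarrow> j \<le> k \<and> k < j + int n \<and> 0 \<le> i \<and> i + k < j + N
     | Down i k \<Rightarrow> j \<le> k \<and> k < j + int n \<and> 0 \<le> i \<and> i + k + 1 < j + N}"

lemma finite_trapezoid: "finite (trapezoid j N n)"
proof (rule finite_subset)
  show "trapezoid j N n \<subseteq> (\<lambda>(i, k). Up i k) ` ({0..<N} \<times> {j..<j + int n})
      \<union> (\<lambda>(i, k). Down i k) ` ({0..<N} \<times> {j..<j + int n})"
  proof
    fix t assume "t \<in> trapezoid j N n"
    then show "t \<in> (\<lambda>(i, k). Up i k) ` ({0..<N} \<times> {j..<j + int n})
        \<union> (\<lambda>(i, k). Down i k) ` ({0..<N} \<times> {j..<j + int n})"
      by (cases t) (force simp: trapezoid_def)+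
  qed
qed simp

text \<open>The line one unit above the base isolates a single row with lower dents
  \<open>xs\<close> and upper dents \<open>S\<close>. For \<open>n = 0\<close> that line is the top
  side, and nothing can cross it.\<close>

lemma M_trapezoid_Suc:
  assumes xs: "sorted_wrt (<) xs" "set xs \<subseteq> {0..<N}" and N: "0 < N"
  shows "M (trapezoid j N (Suc n) - ups j (set xs))
    = (\<Sum>S\<in>Pow (if n = 0 then {} else {0..<N - 1}).
         M (trapezoid (j + 1) (N - 1) n - ups (j + 1) S) * of_bool (interlaces xs (sorted_list_of_set S)))"
proof -
  let ?R = "trapezoid j N (Suc n) - ups j (set xs)"
  have up: "upper (j + 1) ?R = trapezoid (j + 1) (N - 1) n"
    by (rule region_eqI) (auto simp: upper_def trapezoid_def)
  have low: "lower (j + 1) ?R - downs j S = row_from_up j 0 N (set xs) S" for S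
    by (rule region_eqI) (auto simp: lower_def trapezoid_def row_from_up_def)
  have cross: "crossing (j + 1) ?R = (if n = 0 then {} else {0..<N - 1})"
    by (auto simp: crossing_def trapezoid_def)
  have "M ?R = (\<Sum>S\<in>Pow (if n = 0 then {} else {0..<N - 1}).
      M (trapezoid (j + 1) (N - 1) n - ups (j + 1) S) * M (row_from_up j 0 N (set xs) S))"
    using M_split[of ?R "j + 1"] by (simp add: up low cross finite_trapezoid)
  also have "\<dots> = (\<Sum>S\<in>Pow (if n = 0 then {} else {0..<N - 1}).
         M (trapezoid (j + 1) (N - 1) n - ups (j + 1) S) * of_bool (interlaces xs (sorted_list_of_set S)))"
  proof (intro sum.cong refl arg_cong2[where f = "(*)"])
    fix S assume "S \<in> Pow (if n = 0 then {} else {0..<N - 1})"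
    then have S: "S \<subseteq> {0..<N - 1}" by (auto split: if_splits)
    then have "finite S" by (rule finite_subset) simp
    then show "M (row_from_up j 0 N (set xs) S) = of_bool (interlaces xs (sorted_list_of_set S))"
      using M_row[of xs "sorted_list_of_set S" N j] xs S N by simp
  qed
  finally show ?thesis .
qed

section \<open>Trapezoids with dents\<close>

definition vdm :: "int set \<Rightarrow> real" where
  "vdm X = (\<Prod>v\<in>X. \<Prod>u\<in>{u \<in> X. u < v}. real_of_int (v - u))"

lemma vdm_empty [simp]: "vdm {} = 1"
  by (simp add: vdm_def)

text \<open>Absolute values remove the order from the product, so the new point may lie anywhere
  among the old ones.\<close>

lemma vdm_insert:
  assumes "finite X" "v \<notin> X"
  shows "vdm (insert v X) = vdm X * (\<Prod>u\<in>X. \<bar>real_of_int (v - u)\<bar>)"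
proof -
  let ?lo = "{u \<in> X. u < v}" and ?hi = "{u \<in> X. v < u}"
  have "u < v \<or> v < u" if "u \<in> X" for u using that assms(2) by (metis linorder_neqE)
  then have X: "X = ?lo \<union> ?hi" "?lo \<inter> ?hi = {}" by auto
  have "vdm (insert v X) = (\<Prod>u\<in>{u \<in> insert v X. u < v}. real_of_int (v - u))
      * (\<Prod>w\<in>X. \<Prod>u\<in>{u \<in> insert v X. u < w}. real_of_int (w - u))"
    using assms by (simp add: vdm_def)
  also have "{u \<in> insert v X. u < v} = ?lo" by auto
  also have "(\<Prod>w\<in>X. \<Prod>u\<in>{u \<in> insert v X. u < w}. real_of_int (w - u))
      = (\<Prod>w\<in>X. (\<Prod>u\<in>{u \<in> X. u < w}. real_of_int (w - u)) * (if v < w then real_of_int (w - v) else 1))"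
  proof (intro prod.cong refl)
    fix w assume "w \<in> X"
    show "(\<Prod>u\<in>{u \<in> insert v X. u < w}. real_of_int (w - u))
      = (\<Prod>u\<in>{u \<in> X. u < w}. real_of_int (w - u)) * (if v < w then real_of_int (w - v) else 1)"
    proof (cases "v < w")
      case True
      then have "{u \<in> insert v X. u < w} = insert v {u \<in> X. u < w}" by auto
      then show ?thesis using True assms by simp
    next
      case False
      then have "{u \<in> insert v X. u < w} = {u \<in> X. u < w}" by auto
      then show ?thesis using False by simp
    qed
  qed
  also have "\<dots> = vdm X * (\<Prod>w\<in>X. if v < w then real_of_int (w - v) else 1)"
    by (simp add: prod.distrib vdm_def)
  also have "(\<Prod>w\<in>X. if v < w then real_of_int (w - v) else 1) = (\<Prod>w\<in>?hi. real_of_int (w - v))"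
    using assms(1) by (intro prod.mono_neutral_cong_right) auto
  also have "\<dots> = (\<Prod>w\<in>?hi. \<bar>real_of_int (v - w)\<bar>)"
    by (intro prod.cong) auto
  also have "(\<Prod>u\<in>?lo. real_of_int (v - u)) = (\<Prod>u\<in>?lo. \<bar>real_of_int (v - u)\<bar>)"
    by (intro prod.cong) auto
  finally have "vdm (insert v X) = vdm X
      * ((\<Prod>u\<in>?lo. \<bar>real_of_int (v - u)\<bar>) * (\<Prod>w\<in>?hi. \<bar>real_of_int (v - w)\<bar>))"
    by (simp add: mult_ac)
  also have "(\<Prod>u\<in>?lo. \<bar>real_of_int (v - u)\<bar>) * (\<Prod>w\<in>?hi. \<bar>real_of_int (v - w)\<bar>)
      = (\<Prod>u\<in>X. \<bar>real_of_int (v - u)\<bar>)"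
    using assms(1) X(2) by (subst (3) X(1), subst prod.union_disjoint) auto
  finally show ?thesis .
qed

lemma vdm_pos: "finite X \<Longrightarrow> 0 < vdm X"
  unfolding vdm_def by (intro prod_pos) auto

lemma vdm_Un:
  assumes "finite X" "finite Y" "X \<inter> Y = {}"
  shows "vdm (X \<union> Y) = vdm X * vdm Y * (\<Prod>u\<in>X. \<Prod>v\<in>Y. \<bar>real_of_int (u - v)\<bar>)"
  using assms(1,3)
proof (induction X rule: finite_induct)
  case (insert w X)
  have "vdm (insert w X \<union> Y) = vdm (X \<union> Y) * (\<Prod>u\<in>X \<union> Y. \<bar>real_of_int (w - u)\<bar>)"
    using insert assms(2) by (simp add: vdm_insert)
  also have "(\<Prod>u\<in>X \<union> Y. \<bar>real_of_int (w - u)\<bar>)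
      = (\<Prod>u\<in>X. \<bar>real_of_int (w - u)\<bar>) * (\<Prod>u\<in>Y. \<bar>real_of_int (w - u)\<bar>)"
    using insert assms(2) by (intro prod.union_disjoint) auto
  finally show ?case using insert by (simp add: vdm_insert mult_ac)
qed simp

lemma vdm_set:
  "sorted_wrt (<) xs \<Longrightarrow> (\<Prod>i<length xs. \<Prod>l<i. real_of_int (xs ! i - xs ! l)) = vdm (set xs)"
proof (induction xs rule: rev_induct)
  case (snoc w xs)
  then have w: "w \<notin> set xs" "\<And>u. u \<in> set xs \<Longrightarrow> u < w" and sorted: "sorted_wrt (<) xs" "distinct xs"
    by (auto simp: sorted_wrt_append strict_sorted_iff)
  have "(\<Prod>i<length (xs @ [w]). \<Prod>l<i. real_of_int ((xs @ [w]) ! i - (xs @ [w]) ! l))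
      = (\<Prod>i<length xs. \<Prod>l<i. real_of_int (xs ! i - xs ! l)) * (\<Prod>l<length xs. real_of_int (w - xs ! l))"
    by (auto simp: nth_append intro!: arg_cong2[where f = "(*)"] prod.cong)
  also have "(\<Prod>l<length xs. real_of_int (w - xs ! l)) = (\<Prod>u\<in>set xs. real_of_int (w - u))"
    by (rule prod.reindex_bij_betw[of "(!) xs"]) (simp add: bij_betw_nth sorted(2))
  also have "\<dots> = (\<Prod>u\<in>set xs. \<bar>real_of_int (w - u)\<bar>)"
    using w(2) by (intro prod.cong) (auto simp: less_imp_le)
  finally show ?case using snoc.IH sorted w(1) by (simp add: vdm_insert)
qed simp

text \<open>Tilings and determinants obey the same recursion over interlacing sequences. Each row
  uses up one dent, which is why the number of dents must equal the number of rows.\<close>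

lemma M_trapezoid_list:
  "sorted_wrt (<) xs \<Longrightarrow> set xs \<subseteq> (if n = 0 then {} else {0..<N}) \<Longrightarrow> int n \<le> N \<Longrightarrow>
   real (M (trapezoid j N n - ups j (set xs)))
     = (if length xs = n then rowdet (map binom_row xs) else 0)"
proof (induction n arbitrary: j N xs)
  case 0
  have "trapezoid j N 0 = {}" by (auto simp: trapezoid_def split: unit_triangle.splits)
  then show ?case using 0 by (simp add: rowdet_def)
next
  case (Suc n)
  have xs: "set xs \<subseteq> {0..<N}" and N: "0 < N" using Suc.prems by auto
  show ?case
  proof (cases "n = 0")
    case True
    have "trapezoid (j + 1) (N - 1) 0 = {}" by (auto simp: trapezoid_def split: unit_triangle.splits)
    then have "M (trapezoid j N (Suc n) - ups j (set xs)) = of_bool (interlaces xs [])"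
      using M_trapezoid_Suc[OF Suc.prems(1) xs N, of j n] True by simp
    moreover have "rowdet (map binom_row [w]) = 1" for w
      using rowdet_binom[of "[w]"] by simp
    ultimately show ?thesis
      using True by (cases xs; cases "tl xs") auto
  next
    case False
    have IH: "real (M (trapezoid (j + 1) (N - 1) n - ups (j + 1) S))
        = (if card S = n then rowdet (map binom_row (sorted_list_of_set S)) else 0)"
      if "S \<subseteq> {0..<N - 1}" for S
    proof -
      have "finite S" using that by (rule finite_subset) simp
      then show ?thesis
        using Suc.IH[of "sorted_list_of_set S" "N - 1" "j + 1"] that False Suc.prems(3) by simp
    qed
    have "real (M (trapezoid j N (Suc n) - ups j (set xs)))
        = (\<Sum>S\<in>Pow {0..<N - 1}. (if card S = n then rowdet (map binom_row (sorted_list_of_set S)) else 0)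
            * of_bool (interlaces xs (sorted_list_of_set S)))"
      using False IH by (subst M_trapezoid_Suc[OF Suc.prems(1) xs N]) (auto intro!: sum.cong)
    also have "\<dots> = (\<Sum>t | interlaces xs t.
        (if card (set t) = n then rowdet (map binom_row (sorted_list_of_set (set t))) else 0))"
      by (rule sum_interlaces[OF Suc.prems(1) xs])
    also have "\<dots> = (\<Sum>t | interlaces xs t. if length xs = Suc n then rowdet (map binom_row t) else 0)"
    proof (intro sum.cong refl)
      fix t assume "t \<in> {t. interlaces xs t}"
      then have "sorted_wrt (<) t" "length xs = Suc (length t)"
        using interlaces_strict_sorted Suc.prems(1) interlaces_length by auto
      then show "(if card (set t) = n then rowdet (map binom_row (sorted_list_of_set (set t))) else 0)
          = (if length xs = Suc n then rowdet (map binom_row t) else 0)"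
        by (simp add: strict_sorted_iff distinct_card sorted_list_of_set.idem_if_sorted_distinct)
    qed
    also have "\<dots> = (if length xs = Suc n then rowdet (map binom_row xs) else 0)"
      using sum_rowdet_binom_interlaces[of xs] Suc.prems(1)
      by (cases "xs = []") (auto simp: strict_sorted_iff)
    finally show ?thesis .
  qed
qed

text \<open>The formula of Cohn, Larsen and Propp.\<close>

theorem M_trapezoid:
  assumes "S \<subseteq> (if n = 0 then {} else {0..<N})" "int n \<le> N"
  shows "real (M (trapezoid j N n - ups j S)) = (if card S = n then vdm S / real (h n) else 0)"
proof -
  have fin: "finite S" using assms(1) by (rule finite_subset) simp
  then show ?thesis
    using M_trapezoid_list[of "sorted_list_of_set S" n N j] assms
      vdm_set[of "sorted_list_of_set S"] by (auto simp: rowdet_binom h_def)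
qed

section \<open>Triangles standing on the base\<close>

lemma up_triangle_mem:
  "Up i k \<in> up_triangle (p, q) b \<longleftrightarrow> p \<le> i \<and> q \<le> k \<and> i + k + 1 \<le> p + q + int b"
  "Down i k \<in> up_triangle (p, q) b \<longleftrightarrow> p \<le> i \<and> q \<le> k \<and> i + k + 2 \<le> p + q + int b"
  by (auto simp: up_triangle_def region_of_def)

lemma down_triangle_mem:
  "Up i k \<in> down_triangle (p, q) b \<longleftrightarrow> i + 1 \<le> p + int b \<and> k + 1 \<le> q \<and> p + q \<le> i + k"
  "Down i k \<in> down_triangle (p, q) b \<longleftrightarrow> i + 1 \<le> p + int b \<and> k + 1 \<le> q \<and> p + q \<le> i + k + 1"
  by (auto simp: down_triangle_def region_of_def)

lemma M_trapezoid_minus_triangles: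
  assumes I: "\<And>p b. (p, b) \<in> I \<Longrightarrow> 0 \<le> p \<and> p + int b \<le> N \<and> b \<le> n"
  shows "M (trapezoid j N n - (\<Union>(p, b)\<in>I. up_triangle (p, j) b) - ups j S)
       = M (trapezoid j N n - ups j (S \<union> (\<Union>(p, b)\<in>I. {p..<p + int b})))"
proof -
  let ?R = "trapezoid j N n - ups j (S \<union> (\<Union>(p, b)\<in>I. {p..<p + int b}))"
  \<comment> \<open>The down-pointing unit triangles inside the removed triangles. Paired with the
    up-pointing ones above them, they fill each removed triangle except for its bottom row of
    up-pointing triangles, which become dents.\<close>
  define W where "W = {(i, k). j \<le> k \<and> (\<exists>(p, b)\<in>I. p \<le> i \<and> i + k + 2 \<le> p + j + int b)}"
  have "M ?R = M (?R - (\<Union>(i, k)\<in>W. {Down i k, Up i (k + 1)}))"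
  proof (rule M_forced_triangles[where j = j])
    fix i k assume "(i, k) \<in> W"
    then obtain p b where pb: "(p, b) \<in> I" "p \<le> i" "i + k + 2 \<le> p + j + int b" and k: "j \<le> k"
      by (auto simp: W_def)
    note bd = I[OF pb(1)]
    show "j \<le> k \<and> Down i k \<in> ?R \<and> Up i (k + 1) \<in> ?R"
      using pb bd k by (auto simp: trapezoid_def)
    show "(i, k - 1) \<in> W \<and> (i + 1, k - 1) \<in> W" if "j < k"
      using pb that unfolding W_def by (auto intro!: bexI[OF _ pb(1)])
  next
    fix i assume "(i, j) \<in> W"
    then obtain p b where pb: "(p, b) \<in> I" "p \<le> i" "i + j + 2 \<le> p + j + int b"
      by (auto simp: W_def)
    then have "i \<in> {p..<p + int b}" "i + 1 \<in> {p..<p + int b}" by auto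
    then have "i \<in> (\<Union>(p, b)\<in>I. {p..<p + int b})" "i + 1 \<in> (\<Union>(p, b)\<in>I. {p..<p + int b})"
      using pb(1) by blast+
    then show "Up i j \<notin> ?R \<and> Up (i + 1) j \<notin> ?R" by simp
  qed
  also have "?R - (\<Union>(i, k)\<in>W. {Down i k, Up i (k + 1)})
      = trapezoid j N n - (\<Union>(p, b)\<in>I. up_triangle (p, j) b) - ups j S"
  proof (rule region_eqI)
    fix i k
    have "Up i k \<in> (\<Union>(i, k)\<in>W. {Down i k, Up i (k + 1)}) \<longleftrightarrow> (i, k - 1) \<in> W" by force
    moreover have "(\<exists>(p, b)\<in>I. Up i k \<in> up_triangle (p, j) b) \<longleftrightarrow>
      (i, k - 1) \<in> W \<or> (k = j \<and> (\<exists>(p, b)\<in>I. i \<in> {p..<p + int b}))"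
    proof -
      have "Up i k \<in> up_triangle (p, j) b \<longleftrightarrow> (j \<le> k - 1 \<and> p \<le> i \<and> i + (k - 1) + 2 \<le> p + j + int b)
          \<or> (k = j \<and> i \<in> {p..<p + int b})" for p b
        by (auto simp: up_triangle_mem)
      then show ?thesis unfolding W_def by blast
    qed
    ultimately show "Up i k \<in> ?R - (\<Union>(i, k)\<in>W. {Down i k, Up i (k + 1)}) \<longleftrightarrow>
       Up i k \<in> trapezoid j N n - (\<Union>(p, b)\<in>I. up_triangle (p, j) b) - ups j S"
      unfolding Diff_iff Up_in_ups Un_iff by blast
    have "Down i k \<in> (\<Union>(i, k)\<in>W. {Down i k, Up i (k + 1)}) \<longleftrightarrow> (i, k) \<in> W" by force
    moreover have "(\<exists>(p, b)\<in>I. Down i k \<in> up_triangle (p, j) b) \<longleftrightarrow> (i, k) \<in> W"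
    proof -
      have "Down i k \<in> up_triangle (p, j) b \<longleftrightarrow> j \<le> k \<and> p \<le> i \<and> i + k + 2 \<le> p + j + int b" for p b
        by (auto simp: up_triangle_mem)
      then show ?thesis unfolding W_def by blast
    qed
    ultimately show "Down i k \<in> ?R - (\<Union>(i, k)\<in>W. {Down i k, Up i (k + 1)}) \<longleftrightarrow>
       Down i k \<in> trapezoid j N n - (\<Union>(p, b)\<in>I. up_triangle (p, j) b) - ups j S"
      unfolding Diff_iff by (auto simp only: Down_in_ups)
  qed
  finally show ?thesis by simp
qed

definition repulsion :: "int \<Rightarrow> int set \<Rightarrow> int \<Rightarrow> real" where
  "repulsion d E i = (\<Prod>e\<in>E. \<bar>real_of_int (i - e)\<bar>) * (\<Prod>e\<in>(\<lambda>e. d - 1 - e) ` E. \<bar>real_of_int (i - e)\<bar>)"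

text \<open>The reflection is an isometry: the distances from the mirrored \<open>S\<close> to
  \<open>E\<close> are those from \<open>S\<close> to the mirrored \<open>E\<close>. So the
  interaction with \<open>E\<close> in both halves collects in one product over
  \<open>S\<close>.\<close>

lemma vdm_reflect_mult:
  assumes fin: "finite S" "finite E" and disj: "S \<inter> E = {}" "S \<inter> (\<lambda>i. d - 1 - i) ` E = {}"
  shows "vdm (S \<union> E) * vdm ((\<lambda>i. d - 1 - i) ` S \<union> E)
       = vdm S * vdm ((\<lambda>i. d - 1 - i) ` S) * (vdm E)\<^sup>2 * (\<Prod>i\<in>S. repulsion d E i)"
proof -
  let ?\<sigma> = "\<lambda>i::int. d - 1 - i"
  have inj: "inj_on ?\<sigma> A" for A by (auto simp: inj_on_def)
  have disj': "?\<sigma> ` S \<inter> E = {}" using disj(2) by force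
  have "(\<Prod>u\<in>?\<sigma> ` S. \<Prod>v\<in>E. \<bar>real_of_int (u - v)\<bar>) = (\<Prod>i\<in>S. \<Prod>v\<in>E. \<bar>real_of_int (?\<sigma> i - v)\<bar>)"
    by (subst prod.reindex[OF inj]) simp
  also have "\<dots> = (\<Prod>i\<in>S. \<Prod>e\<in>?\<sigma> ` E. \<bar>real_of_int (i - e)\<bar>)"
  proof (rule prod.cong[OF refl])
    fix i
    have "(\<Prod>e\<in>?\<sigma> ` E. \<bar>real_of_int (i - e)\<bar>) = (\<Prod>v\<in>E. \<bar>real_of_int (i - ?\<sigma> v)\<bar>)"
      by (subst prod.reindex[OF inj]) simp
    then show "(\<Prod>v\<in>E. \<bar>real_of_int (?\<sigma> i - v)\<bar>) = (\<Prod>e\<in>?\<sigma> ` E. \<bar>real_of_int (i - e)\<bar>)"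
      by (simp add: abs_minus_commute algebra_simps)
  qed
  finally show ?thesis
    using fin disj(1) disj'
    by (simp add: vdm_Un repulsion_def prod.distrib power2_eq_square mult_ac)
qed

section \<open>Fern-cored hexagons\<close>

lemma sum_list_take_rev:
  assumes "rev bs = bs"
  shows "sum_list (take (length bs - i) bs) + sum_list (take i bs) = (sum_list bs :: nat)"
proof -
  have "take (length bs - i) bs = rev (drop i bs)"
    by (metis assms rev_drop rev_rev_ident)
  then have "sum_list (take (length bs - i) bs) = sum_list (drop i bs)" by simp
  then show ?thesis
    by (metis add.commute append_take_drop_id sum_list_append)
qed

lemma sum_list_take_Suc:
  "l < length bs \<Longrightarrow> sum_list (take (Suc l) bs) = sum_list (take l bs) + (bs ! l :: nat)"
  by (simp add: take_Suc_conv_app_nth)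

lemma hexagon_mem:
  "Up i k \<in> hexagon X Y Z \<longleftrightarrow> 0 \<le> i \<and> i + 1 \<le> int X + int Y \<and> - int Y \<le> k \<and> k + 1 \<le> int Z
     \<and> 0 \<le> i + k \<and> i + k + 1 \<le> int X + int Z"
  "Down i k \<in> hexagon X Y Z \<longleftrightarrow> 0 \<le> i \<and> i + 1 \<le> int X + int Y \<and> - int Y \<le> k \<and> k + 1 \<le> int Z
     \<and> 0 \<le> i + k + 1 \<and> i + k + 2 \<le> int X + int Z"
  by (auto simp: hexagon_def region_of_def)

lemma finite_hexagon: "finite (hexagon X Y Z)"
proof (rule finite_subset)
  let ?D = "{0..int X + int Y} \<times> {- int Y..int Z}"
  show "hexagon X Y Z \<subseteq> (\<lambda>(i, k). Up i k) ` ?D \<union> (\<lambda>(i, k). Down i k) ` ?D"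
  proof
    fix t assume "t \<in> hexagon X Y Z"
    then show "t \<in> (\<lambda>(i, k). Up i k) ` ?D \<union> (\<lambda>(i, k). Down i k) ` ?D"
      by (cases t) (force simp: hexagon_mem)+
  qed
qed simp

lemma h_pos: "0 < h m"
  by (simp add: h_def prod_pos)

text \<open>Only the hexagon is fixed, as two ferns inside it are to be compared. Evenness makes the
  centre a lattice point and the divisions by 2 below exact.\<close>

locale fern_cored_hexagon =
  fixes x y z a :: nat
  assumes even_sides: "even x" "even y" "even z"
begin

text \<open>\<open>left\<close> and \<open>line\<close> are the coordinates of the base point of the
  fern, and \<open>centre\<close> is the doubled first coordinate of the centre.
  \<open>height\<close> and \<open>width\<close> are the number of rows and the base length of the
  trapezoid around the upper half.\<close>

definition line :: int where "line = (int z - int y) div 2"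
definition left :: int where "left = (int x + int y) div 2"
definition centre :: int where "centre = int x + int y + 2 * int a"
definition height :: nat where "height = (y + z) div 2 + a"
definition width :: int where "width = centre + line"

definition mirror :: "int \<Rightarrow> int" where "mirror i = centre - 1 - i"

lemma params:
  "2 * line = int z - int y" "2 * left = int x + int y" "2 * int height = int y + int z + 2 * int a"
  "centre = 2 * left + 2 * int a" "width = int x + int a + int height"
proof -
  obtain x' y' z' where "x = 2 * x'" "y = 2 * y'" "z = 2 * z'"
    using even_sides by (auto elim!: evenE)
  then show "2 * line = int z - int y" "2 * left = int x + int y"
    "2 * int height = int y + int z + 2 * int a"
    "centre = 2 * left + 2 * int a" "width = int x + int a + int height"
    unfolding width_def line_def left_def centre_def height_def by simp_all
qed

definition base :: "int set" where "base = (if height = 0 then {} else {0..<width})"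

text \<open>The upper half of the hexagon is the trapezoid with a triangle cut off at its right or left
  corner, depending on the sign of \<open>line\<close>.\<close>

definition corner :: "int \<times> nat" where
  "corner = (if 0 \<le> line then (centre, nat line) else (0, nat (- line)))"

definition corner_set :: "int set" where
  "corner_set = {fst corner..<fst corner + int (snd corner)}"

definition fern_set :: "int set" where "fern_set = {left..<left + 2 * int a}"

definition lobe :: "nat list \<Rightarrow> nat \<Rightarrow> int set" where
  "lobe bs l = {left + int (sum_list (take l bs))..<left + int (sum_list (take (Suc l) bs))}"

definition up_lobes :: "nat list \<Rightarrow> int set" where
  "up_lobes bs = (\<Union>l\<in>{l. l < length bs \<and> even l}. lobe bs l)"

definition dents :: "nat list \<Rightarrow> int set" where
  "dents bs = up_lobes bs \<union> corner_set"

text \<open>Reversing a list of even length changes the parity of every position, so for a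
  palindrome the rotation exchanges up- and down-pointing lobes.\<close>

definition balanced :: "nat list \<Rightarrow> bool" where
  "balanced bs \<longleftrightarrow> even (length bs) \<and> rev bs = bs \<and> sum_list bs = 2 * a"

lemma mirror_mirror [simp]: "mirror (mirror i) = i"
  by (simp add: mirror_def)

lemma inj_mirror: "inj_on mirror A"
  by (auto simp: inj_on_def mirror_def)

lemma mem_mirror_image: "i \<in> mirror ` A \<longleftrightarrow> mirror i \<in> A"
  by (metis image_iff mirror_mirror)

lemma finite_sets [simp]: "finite base" "finite corner_set" "finite fern_set" "finite (up_lobes bs)" "finite (dents bs)"
  by (auto simp: base_def corner_set_def fern_set_def up_lobes_def lobe_def dents_def)

lemma lobe_mirror:
  assumes "balanced bs" "l < length bs"
  shows "mirror i \<in> lobe bs l \<longleftrightarrow> i \<in> lobe bs (length bs - 1 - l)"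
proof -
  have "Suc (length bs - 1 - l) = length bs - l" "length bs - 1 - l = length bs - Suc l"
    using assms(2) by auto
  moreover have "sum_list (take (length bs - l) bs) + sum_list (take l bs) = 2 * a"
    "sum_list (take (length bs - Suc l) bs) + sum_list (take (Suc l) bs) = 2 * a"
    using sum_list_take_rev[of bs] assms(1) by (auto simp: balanced_def)
  ultimately show ?thesis
    using params(4) by (auto simp: lobe_def mirror_def)
qed

lemma lobe_covers:
  "l \<le> length bs \<Longrightarrow> (\<Union>m<l. lobe bs m) = {left..<left + int (sum_list (take l bs))}"
proof (induction l)
  case (Suc l)
  then show ?case by (auto simp: lessThan_Suc lobe_def sum_list_take_Suc)
qed simp

lemma lobe_disjoint:
  assumes "l < m" "m < length bs"
  shows "lobe bs l \<inter> lobe bs m = {}"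
proof -
  have "take (Suc l) bs = take (Suc l) (take m bs)" using assms by (simp add: min_def)
  then have "sum_list (take (Suc l) bs) \<le> sum_list (take m bs)"
    by (metis append_take_drop_id le_add1 sum_list_append)
  then show ?thesis by (auto simp: lobe_def)
qed

lemma mirror_up_lobes:
  assumes "balanced bs"
  shows "mirror ` up_lobes bs = (\<Union>l\<in>{l. l < length bs \<and> odd l}. lobe bs l)"
proof -
  have "i \<in> mirror ` up_lobes bs \<longleftrightarrow> (\<exists>l<length bs. odd l \<and> i \<in> lobe bs l)" for i
  proof
    assume "i \<in> mirror ` up_lobes bs"
    then obtain l where l: "l < length bs" "even l" "mirror i \<in> lobe bs l"
      by (auto simp: mem_mirror_image up_lobes_def)
    then have "i \<in> lobe bs (length bs - 1 - l)" using lobe_mirror[OF assms] by simp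
    moreover have "odd (length bs - 1 - l)" using l assms by (auto simp: balanced_def)
    ultimately show "\<exists>l<length bs. odd l \<and> i \<in> lobe bs l" using l(1)
      by (intro exI[of _ "length bs - 1 - l"]) auto
  next
    assume "\<exists>l<length bs. odd l \<and> i \<in> lobe bs l"
    then obtain l where l: "l < length bs" "odd l" "i \<in> lobe bs l" by blast
    let ?m = "length bs - 1 - l"
    have "length bs - 1 - ?m = l" "?m < length bs" "even ?m"
      using l assms by (auto simp: balanced_def)
    then have "mirror i \<in> lobe bs ?m" using lobe_mirror[OF assms, of ?m i] l by simp
    then show "i \<in> mirror ` up_lobes bs"
      using \<open>?m < length bs\<close> \<open>even ?m\<close> by (auto simp: mem_mirror_image up_lobes_def)
  qed
  then show ?thesis by blast
qed

lemma up_lobes_Un: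
  assumes "balanced bs"
  shows "up_lobes bs \<union> mirror ` up_lobes bs = fern_set"
proof -
  have "up_lobes bs \<union> mirror ` up_lobes bs = (\<Union>l<length bs. lobe bs l)"
    unfolding mirror_up_lobes[OF assms] unfolding up_lobes_def by blast
  also have "\<dots> = fern_set" using assms by (simp add: lobe_covers fern_set_def balanced_def)
  finally show ?thesis .
qed

lemma up_lobes_Int:
  assumes "balanced bs"
  shows "up_lobes bs \<inter> mirror ` up_lobes bs = {}"
proof -
  have "lobe bs l \<inter> lobe bs m = {}" if "l < length bs" "m < length bs" "even l" "odd m" for l m
    using lobe_disjoint[of l m bs] lobe_disjoint[of m l bs] that by (cases l m rule: linorder_cases) auto
  then show ?thesis unfolding mirror_up_lobes[OF assms] unfolding up_lobes_def by fast
qed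

text \<open>The up-pointing lobes and their mirror images split the \<open>2 * a\<close> positions
  of the fern into two sets of equal size.\<close>

lemma card_up_lobes:
  assumes "balanced bs"
  shows "card (up_lobes bs) = a"
proof -
  have "card (up_lobes bs \<union> mirror ` up_lobes bs) = card (up_lobes bs) + card (mirror ` up_lobes bs)"
    using up_lobes_Int[OF assms] by (intro card_Un_disjoint) auto
  then show ?thesis
    using up_lobes_Un[OF assms] by (simp add: card_image inj_mirror fern_set_def)
qed

lemma card_up_lobes_odd_sum: "card (up_lobes bs) = odd_sum bs"
proof -
  have "card (up_lobes bs) = (\<Sum>l | l < length bs \<and> even l. card (lobe bs l))"
    unfolding up_lobes_def
  proof (rule card_UN_disjoint)
    have "lobe bs l \<inter> lobe bs m = {}" if "l < length bs" "m < length bs" "l \<noteq> m" for l m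
      using lobe_disjoint[of l m bs] lobe_disjoint[of m l bs] that by (cases l m rule: linorder_cases) auto
    then show "\<forall>l\<in>{l. l < length bs \<and> even l}. \<forall>m\<in>{l. l < length bs \<and> even l}.
        l \<noteq> m \<longrightarrow> lobe bs l \<inter> lobe bs m = {}" by blast
  qed (auto simp: lobe_def)
  also have "\<dots> = odd_sum bs"
    unfolding odd_sum_def by (intro sum.cong) (auto simp: lobe_def sum_list_take_Suc)
  finally show ?thesis .
qed

lemma odd_sum_balanced: "balanced bs \<Longrightarrow> odd_sum bs = a"
  using card_up_lobes card_up_lobes_odd_sum by metis

lemma corner_fern_disjoint: "corner_set \<inter> fern_set = {}"
  using params by (auto simp: corner_set_def corner_def fern_set_def)

lemma up_lobes_subset: "balanced bs \<Longrightarrow> up_lobes bs \<subseteq> fern_set"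
  using up_lobes_Un by blast

lemma card_dents: "balanced bs \<Longrightarrow> card (dents bs) = a + nat \<bar>line\<bar>"
proof -
  assume b: "balanced bs"
  have "card (dents bs) = card (up_lobes bs) + card corner_set"
    unfolding dents_def using up_lobes_subset[OF b] corner_fern_disjoint
    by (intro card_Un_disjoint) auto
  then show ?thesis by (simp add: card_up_lobes[OF b] corner_set_def corner_def)
qed

lemma dents_subset_base: "balanced bs \<Longrightarrow> dents bs \<subseteq> base"
proof (cases "height = 0")
  case True
  assume b: "balanced bs"
  have "a = 0" "int y = 0" "int z = 0" using True params(3) by auto
  then have "card (dents bs) = 0" using card_dents[OF b] params(1) by simp
  then show ?thesis by simp
next
  case False
  assume "balanced bs"
  then have "dents bs \<subseteq> fern_set \<union> corner_set" using up_lobes_subset by (auto simp: dents_def)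
  also have "\<dots> \<subseteq> {0..<width}"
    using params by (auto simp: fern_set_def corner_set_def corner_def width_def)
  finally show ?thesis using False by (simp add: base_def)
qed

lemma fern_mem:
  "t \<in> fern (left, line) bs \<longleftrightarrow> (\<exists>l<length bs.
     if even l then t \<in> up_triangle (left + int (sum_list (take l bs)), line) (bs ! l)
     else t \<in> down_triangle (left + int (sum_list (take l bs)), line) (bs ! l))"
  by (auto simp: fern_def Let_def)

lemma FC_eq:
  "balanced bs \<Longrightarrow> FC x y z bs = hexagon (x + a) (y + a) (z + a) - fern (left, line) bs"
  by (simp add: FC_def odd_sum_balanced left_def line_def Let_def)

lemma FC_centre2_eq: "balanced bs \<Longrightarrow> FC_centre2 x y z bs = (centre, 2 * line)"
  using params(1) by (simp add: FC_centre2_def hexagon_centre2_def odd_sum_balanced Let_def centre_def)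

text \<open>The missing corner counts as one more up-pointing triangle on the base, so the forced
  lozenges are treated for it and the lobes at once.\<close>

definition holes :: "nat list \<Rightarrow> (int \<times> nat) set" where
  "holes bs = insert corner ((\<lambda>l. (left + int (sum_list (take l bs)), bs ! l)) ` {l. l < length bs \<and> even l})"

lemma dents_holes: "dents bs = (\<Union>(q, b)\<in>holes bs. {q..<q + int b})"
  by (auto simp: dents_def holes_def corner_set_def up_lobes_def lobe_def sum_list_take_Suc
      split: prod.splits)

text \<open>The western corner of the hexagon has height 0 and the eastern one
  \<open>2 * line\<close>, so at most one of them is strictly above the line. The side descending
  from that one cuts the triangle off the trapezoid.\<close>

lemma hexagon_upper_mem:
  assumes "line \<le> k"
  shows "Up i k \<in> hexagon (x + a) (y + a) (z + a) \<longleftrightarrow>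
      Up i k \<in> trapezoid line width height \<and> Up i k \<notin> up_triangle (fst corner, line) (snd corner)"
    and "Down i k \<in> hexagon (x + a) (y + a) (z + a) \<longleftrightarrow>
      Down i k \<in> trapezoid line width height \<and> Down i k \<notin> up_triangle (fst corner, line) (snd corner)"
  using assms params unfolding hexagon_mem trapezoid_def corner_def
  by (auto simp: up_triangle_mem width_def centre_def)

lemma upper_FC:
  assumes "balanced bs"
  shows "upper line (FC x y z bs) = trapezoid line width height - (\<Union>(q, b)\<in>holes bs. up_triangle (q, line) b)"
proof -
  have fern: "t \<in> fern (left, line) bs \<longleftrightarrow> (\<exists>l<length bs. even l \<and>
      t \<in> up_triangle (left + int (sum_list (take l bs)), line) (bs ! l))" if "line \<le> triangle_row t" for t
  proof -
    have "t \<notin> down_triangle (q, line) b" for q b using that by (cases t) (auto simp: down_triangle_mem)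
    then show ?thesis by (auto simp: fern_mem)
  qed
  have holes: "t \<in> (\<Union>(q, b)\<in>holes bs. up_triangle (q, line) b) \<longleftrightarrow>
      t \<in> up_triangle (fst corner, line) (snd corner) \<or> (\<exists>l<length bs. even l \<and>
      t \<in> up_triangle (left + int (sum_list (take l bs)), line) (bs ! l))" for t
    by (auto simp: holes_def split: prod.splits)
  have trap: "t \<in> trapezoid line width height \<Longrightarrow> line \<le> triangle_row t" for t
    by (cases t) (auto simp: trapezoid_def)
  have "t \<in> upper line (FC x y z bs) \<longleftrightarrow>
    t \<in> trapezoid line width height - (\<Union>(q, b)\<in>holes bs. up_triangle (q, line) b)" for t
  proof (cases "line \<le> triangle_row t")
    case True
    then have "t \<in> hexagon (x + a) (y + a) (z + a) \<longleftrightarrow>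
      t \<in> trapezoid line width height \<and> t \<notin> up_triangle (fst corner, line) (snd corner)"
      using hexagon_upper_mem by (cases t) auto
    then show ?thesis using fern[OF True] holes[of t] True by (simp add: upper_def FC_eq[OF assms])
  next
    case False
    then show ?thesis using trap by (auto simp: upper_def)
  qed
  then show ?thesis by blast
qed

section \<open>Central symmetry of the region and its crossings\<close>

lemma rotate_up_triangle_mem:
  "rotate_triangle (centre, 2 * line) t \<in> up_triangle (q, line) b \<longleftrightarrow>
     t \<in> down_triangle (centre - q - int b, line) b"
  "rotate_triangle (centre, 2 * line) t \<in> down_triangle (q, line) b \<longleftrightarrow>
     t \<in> up_triangle (centre - q - int b, line) b"
  by (cases t; auto simp: up_triangle_mem down_triangle_mem)+

lemma rotate_hexagon_mem:
  "rotate_triangle (centre, 2 * line) t \<in> hexagon (x + a) (y + a) (z + a) \<longleftrightarrow>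
     t \<in> hexagon (x + a) (y + a) (z + a)"
  using params(1) by (cases t) (auto simp: hexagon_mem centre_def)

lemma rotate_fern_mem:
  assumes b: "balanced bs" and "t \<in> fern (left, line) bs"
  shows "rotate_triangle (centre, 2 * line) t \<in> fern (left, line) bs"
proof -
  obtain l where l: "l < length bs"
     "if even l then t \<in> up_triangle (left + int (sum_list (take l bs)), line) (bs ! l)
      else t \<in> down_triangle (left + int (sum_list (take l bs)), line) (bs ! l)"
    using assms(2) fern_mem by blast
  let ?m = "length bs - 1 - l"
  have m: "?m < length bs" "even ?m \<longleftrightarrow> odd l" "?m = length bs - Suc l"
    using l b by (auto simp: balanced_def)
  have bm: "bs ! ?m = bs ! l"
    using b rev_nth[of ?m bs] l(1) by (auto simp: balanced_def)
  have "sum_list (take ?m bs) + sum_list (take (Suc l) bs) = 2 * a"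
    using sum_list_take_rev[of bs "Suc l"] b m(3) by (auto simp: balanced_def)
  then have E: "centre - (left + int (sum_list (take ?m bs))) - int (bs ! ?m)
     = left + int (sum_list (take l bs))"
    using params(4) bm l(1) by (simp add: sum_list_take_Suc)
  have "if even ?m then rotate_triangle (centre, 2 * line) t
        \<in> up_triangle (left + int (sum_list (take ?m bs)), line) (bs ! ?m)
      else rotate_triangle (centre, 2 * line) t
        \<in> down_triangle (left + int (sum_list (take ?m bs)), line) (bs ! ?m)"
    using l(2) m(2) unfolding rotate_up_triangle_mem E unfolding bm by presburger
  then show ?thesis using m(1) fern_mem by blast
qed

lemma rotate_FC:
  assumes "balanced bs"
  shows "rotate_triangle (centre, 2 * line) ` FC x y z bs = FC x y z bs"
proof -
  have "rotate_triangle (centre, 2 * line) t \<in> FC x y z bs" if "t \<in> FC x y z bs" for t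
    using that rotate_fern_mem[OF assms, of "rotate_triangle (centre, 2 * line) t"]
    by (auto simp: FC_eq[OF assms] rotate_hexagon_mem)
  then show ?thesis by (metis (no_types, lifting) image_subsetI image_eqI rotate_triangle_involution subsetI subset_antisym)
qed

lemma finite_FC: "balanced bs \<Longrightarrow> finite (FC x y z bs)"
  by (simp add: FC_eq finite_hexagon)

text \<open>No list of lobes occurs: a fern position is blocked from above by an up-pointing lobe or
  from below by a down-pointing one, however the fern is divided.\<close>

definition free :: "int set" where
  "free = {i \<in> base. mirror i \<in> base \<and> i \<notin> fern_set \<and> i \<notin> corner_set \<and> mirror i \<notin> corner_set}"

lemma Up_line_in_FC:
  assumes "balanced bs"
  shows "Up i line \<in> FC x y z bs \<longleftrightarrow> i \<in> base - dents bs"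
proof -
  have "Up i line \<in> FC x y z bs \<longleftrightarrow> Up i line \<in> upper line (FC x y z bs)"
    by (simp add: upper_def)
  also have "\<dots> \<longleftrightarrow> i \<in> base - dents bs"
  proof -
    have "Up i line \<in> up_triangle (q, line) b \<longleftrightarrow> i \<in> {q..<q + int b}" for q b
      by (auto simp: up_triangle_mem)
    then have "Up i line \<in> (\<Union>(q, b)\<in>holes bs. up_triangle (q, line) b) \<longleftrightarrow> i \<in> dents bs"
      unfolding dents_holes by blast
    moreover have "Up i line \<in> trapezoid line width height \<longleftrightarrow> i \<in> base"
      by (auto simp: trapezoid_def base_def)
    ultimately show ?thesis unfolding upper_FC[OF assms] by blast
  qed
  finally show ?thesis .
qed

lemma crossing_FC:
  assumes "balanced bs"
  shows "crossing line (FC x y z bs) = free"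
proof -
  have "Down i (line - 1) \<in> FC x y z bs \<longleftrightarrow> Up (mirror i) line \<in> FC x y z bs" for i
  proof -
    have eq: "rotate_triangle (centre, 2 * line) (Up (mirror i) line) = Down i (line - 1)"
      "rotate_triangle (centre, 2 * line) (Down i (line - 1)) = Up (mirror i) line"
      by (simp_all add: mirror_def)
    show ?thesis using rotate_FC[OF assms] eq by (metis imageI)
  qed
  then have "i \<in> crossing line (FC x y z bs) \<longleftrightarrow> i \<in> base - dents bs \<and> mirror i \<in> base - dents bs" for i
    by (simp add: crossing_def Up_line_in_FC[OF assms])
  moreover have "i \<notin> up_lobes bs \<and> mirror i \<notin> up_lobes bs \<longleftrightarrow> i \<notin> fern_set" for i
    using up_lobes_Un[OF assms] mem_mirror_image by blast
  ultimately show ?thesis unfolding free_def dents_def by blast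
qed

text \<open>The condition equates the number of dents with the number of rows; it amounts to
  \<open>card S = min y z\<close>.\<close>

lemma M_upper_FC:
  assumes b: "balanced bs" and S: "S \<subseteq> free"
  shows "real (M (upper line (FC x y z bs) - ups line S))
    = (if card S + (a + nat \<bar>line\<bar>) = height then vdm (S \<union> dents bs) / real (h height) else 0)"
proof -
  have I: "0 \<le> q \<and> q + int c \<le> width \<and> c \<le> height" if hole: "(q, c) \<in> holes bs" for q c
  proof (cases "(q, c) = corner")
    case True
    then show ?thesis using params by (auto simp: corner_def width_def split: if_splits)
  next
    case False
    then obtain l where l: "l < length bs" "even l" "q = left + int (sum_list (take l bs))" "c = bs ! l"
      using hole by (auto simp: holes_def)
    have "c \<le> odd_sum bs" unfolding odd_sum_def l(4) using l by (intro member_le_sum) auto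
    then have "c \<le> height" using odd_sum_balanced[OF b] by (simp add: height_def)
    moreover have "sum_list (take (Suc l) bs) \<le> sum_list bs"
      by (metis append_take_drop_id le_add1 sum_list_append)
    then have "sum_list (take l bs) + c \<le> 2 * a"
      using l b by (simp add: sum_list_take_Suc balanced_def)
    ultimately show ?thesis using params l(3) by (auto simp: width_def)
  qed
  have "M (upper line (FC x y z bs) - ups line S) = M (trapezoid line width height - ups line (S \<union> dents bs))"
    unfolding upper_FC[OF b] dents_holes by (rule M_trapezoid_minus_triangles[OF I])
  moreover have "S \<union> dents bs \<subseteq> (if height = 0 then {} else {0..<width})"
    using dents_subset_base[OF b] S unfolding base_def[symmetric] free_def by blast
  moreover have "int height \<le> width" using params(5) by simp
  moreover have "card (S \<union> dents bs) = card S + (a + nat \<bar>line\<bar>)"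
  proof -
    have "finite S" using S finite_subset[of S base] by (auto simp: free_def)
    moreover have "S \<inter> dents bs = {}"
      using S up_lobes_subset[OF b] by (auto simp: free_def dents_def)
    ultimately show ?thesis by (simp add: card_Un_disjoint card_dents[OF b])
  qed
  ultimately show ?thesis by (simp add: M_trapezoid)
qed

section \<open>Factoring the lobes out of both counts\<close>

definition weight :: "int \<Rightarrow> real" where
  "weight i = repulsion centre corner_set i * (\<Prod>e\<in>fern_set. \<bar>real_of_int (i - e)\<bar>)"

lemma repulsion_dents:
  assumes b: "balanced bs"
  shows "repulsion centre (dents bs) i = weight i"
proof -
  let ?f = "\<lambda>e. \<bar>real_of_int (i - e)\<bar>"
  have disj: "up_lobes bs \<inter> corner_set = {}"
    using up_lobes_subset[OF b] corner_fern_disjoint by blast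
  then have disj': "mirror ` up_lobes bs \<inter> mirror ` corner_set = {}"
    using inj_on_image_Int[OF inj_mirror[of UNIV], of "up_lobes bs" corner_set] by simp
  have m: "(\<lambda>e. centre - 1 - e) = mirror" by (simp add: fun_eq_iff mirror_def)
  have "prod ?f (dents bs) = prod ?f (up_lobes bs) * prod ?f corner_set"
    unfolding dents_def using disj by (intro prod.union_disjoint) auto
  moreover have "prod ?f (mirror ` dents bs) = prod ?f (mirror ` up_lobes bs) * prod ?f (mirror ` corner_set)"
    unfolding dents_def image_Un using disj' by (intro prod.union_disjoint) auto
  moreover have "prod ?f fern_set = prod ?f (up_lobes bs) * prod ?f (mirror ` up_lobes bs)"
    unfolding up_lobes_Un[OF b, symmetric] using up_lobes_Int[OF b] by (intro prod.union_disjoint) auto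
  ultimately show ?thesis by (simp add: repulsion_def weight_def m)
qed

lemma vdm_mirror_mult:
  assumes b: "balanced bs" and S: "S \<subseteq> free"
  shows "vdm (S \<union> dents bs) * vdm (mirror ` S \<union> dents bs)
       = vdm S * vdm (mirror ` S) * (vdm (dents bs))\<^sup>2 * (\<Prod>i\<in>S. weight i)"
proof -
  have m: "(\<lambda>e. centre - 1 - e) = mirror" by (simp add: fun_eq_iff mirror_def)
  have "finite S" using S finite_subset[of S base] by (auto simp: free_def)
  moreover have "S \<inter> dents bs = {}" "S \<inter> mirror ` dents bs = {}"
    using S up_lobes_Un[OF b] by (auto simp: free_def dents_def image_Un mem_mirror_image)
  ultimately show ?thesis
    using vdm_reflect_mult[of S "dents bs" centre] by (simp add: m repulsion_dents[OF b])
qed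

definition total :: real where
  "total = (\<Sum>S\<in>Pow free. if card S + (a + nat \<bar>line\<bar>) = height
     then vdm S * vdm (mirror ` S) * (\<Prod>i\<in>S. weight i) / (real (h height))\<^sup>2 else 0)"

text \<open>The weights measure the interaction of \<open>S\<close> with the dents in both halves
  together; for a self-mirrored \<open>S\<close> one half accounts for the square root.\<close>

definition symmetric_total :: real where
  "symmetric_total = (\<Sum>S | S \<subseteq> free \<and> mirror ` S = S. if card S + (a + nat \<bar>line\<bar>) = height
     then vdm S * sqrt (\<Prod>i\<in>S. weight i) / real (h height) else 0)"

lemma finite_free: "finite free"
  by (rule finite_subset[of _ base]) (auto simp: free_def)

lemma mirror_free: "S \<subseteq> free \<Longrightarrow> mirror ` S \<subseteq> free"
proof -
  have "mirror i \<in> fern_set \<longleftrightarrow> i \<in> fern_set" for i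
    using params(4) by (auto simp: mirror_def fern_set_def)
  then show "S \<subseteq> free \<Longrightarrow> mirror ` S \<subseteq> free" by (auto simp: free_def)
qed

theorem M_FC:
  assumes b: "balanced bs"
  shows "real (M (FC x y z bs)) = (vdm (dents bs))\<^sup>2 * total"
proof -
  have m: "(\<lambda>e. centre - 1 - e) = mirror" by (simp add: fun_eq_iff mirror_def)
  have "real (M (FC x y z bs)) = (\<Sum>S\<in>Pow free.
      real (M (upper line (FC x y z bs) - ups line S)) * real (M (upper line (FC x y z bs) - ups line (mirror ` S))))"
    using M_split_symmetric[OF finite_FC[OF b] rotate_FC[OF b]] by (simp add: m crossing_FC[OF b])
  also have "\<dots> = (\<Sum>S\<in>Pow free. (vdm (dents bs))\<^sup>2 * (if card S + (a + nat \<bar>line\<bar>) = height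
     then vdm S * vdm (mirror ` S) * (\<Prod>i\<in>S. weight i) / (real (h height))\<^sup>2 else 0))"
  proof (intro sum.cong refl)
    fix S assume "S \<in> Pow free"
    then have S: "S \<subseteq> free" "mirror ` S \<subseteq> free" using mirror_free by auto
    have card: "card (mirror ` S) = card S" by (simp add: card_image inj_mirror)
    show "real (M (upper line (FC x y z bs) - ups line S)) * real (M (upper line (FC x y z bs) - ups line (mirror ` S)))
      = (vdm (dents bs))\<^sup>2 * (if card S + (a + nat \<bar>line\<bar>) = height
     then vdm S * vdm (mirror ` S) * (\<Prod>i\<in>S. weight i) / (real (h height))\<^sup>2 else 0)"
      using vdm_mirror_mult[OF b S(1)]
      by (simp add: M_upper_FC[OF b S(1)] M_upper_FC[OF b S(2)] card power2_eq_square mult_ac)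
  qed
  finally show ?thesis by (simp add: total_def sum_distrib_left)
qed

lemma weight_pos: "i \<in> free \<Longrightarrow> 0 < weight i"
proof -
  assume i: "i \<in> free"
  have m: "(\<lambda>e. centre - 1 - e) = mirror" by (simp add: fun_eq_iff mirror_def)
  have "i \<notin> mirror ` corner_set" using i by (simp add: mem_mirror_image free_def)
  moreover have "0 < (\<Prod>e\<in>A. \<bar>real_of_int (i - e)\<bar>)" if "i \<notin> A" for A
    using that by (intro prod_pos) auto
  ultimately show ?thesis
    using i unfolding weight_def repulsion_def m by (auto simp: free_def)
qed

theorem M_odot_FC:
  assumes b: "balanced bs"
  shows "real (M_odot (FC_centre2 x y z bs) (FC x y z bs)) = vdm (dents bs) * symmetric_total"
proof -
  have m: "(\<lambda>e. centre - 1 - e) = mirror" by (simp add: fun_eq_iff mirror_def)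
  have "real (M_odot (FC_centre2 x y z bs) (FC x y z bs)) = (\<Sum>S | S \<subseteq> free \<and> mirror ` S = S.
      real (M (upper line (FC x y z bs) - ups line S)))"
    using M_odot_split[OF finite_FC[OF b] rotate_FC[OF b]]
    by (simp add: m crossing_FC[OF b] FC_centre2_eq[OF b])
  also have "\<dots> = (\<Sum>S | S \<subseteq> free \<and> mirror ` S = S. vdm (dents bs) * (if card S + (a + nat \<bar>line\<bar>) = height
     then vdm S * sqrt (\<Prod>i\<in>S. weight i) / real (h height) else 0))"
  proof (intro sum.cong refl)
    fix S assume "S \<in> {S. S \<subseteq> free \<and> mirror ` S = S}"
    then have S: "S \<subseteq> free" "mirror ` S = S" by auto
    have fin: "finite S" using S(1) finite_free by (rule finite_subset)
    \<comment> \<open>Since \<open>S\<close> is its own mirror image, both factors of the product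
      for the two halves coincide; positivity then allows taking roots.\<close>
    have "(vdm (S \<union> dents bs))\<^sup>2 = (vdm S)\<^sup>2 * (vdm (dents bs))\<^sup>2 * (\<Prod>i\<in>S. weight i)"
      using vdm_mirror_mult[OF b S(1)] S(2) by (simp add: power2_eq_square)
    then have "sqrt ((vdm (S \<union> dents bs))\<^sup>2) = sqrt ((vdm S)\<^sup>2 * (vdm (dents bs))\<^sup>2 * (\<Prod>i\<in>S. weight i))"
      by (rule arg_cong)
    then have "vdm (S \<union> dents bs) = vdm S * vdm (dents bs) * sqrt (\<Prod>i\<in>S. weight i)"
      using vdm_pos[of "S \<union> dents bs"] vdm_pos[of S] vdm_pos[of "dents bs"] fin
      by (simp add: real_sqrt_mult)
    then show "real (M (upper line (FC x y z bs) - ups line S))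
      = vdm (dents bs) * (if card S + (a + nat \<bar>line\<bar>) = height
     then vdm S * sqrt (\<Prod>i\<in>S. weight i) / real (h height) else 0)"
      by (simp add: M_upper_FC[OF b S(1)] mult_ac)
  qed
  finally show ?thesis by (simp add: symmetric_total_def sum_distrib_left)
qed

text \<open>Guarantees a positive summand in \<open>total\<close> and in
  \<open>symmetric_total\<close>, so that both can be cancelled in the ratios.\<close>

lemma ex_symmetric_free: "\<exists>S. S \<subseteq> free \<and> mirror ` S = S \<and> card S + (a + nat \<bar>line\<bar>) = height"
proof -
  \<comment> \<open>An admissible \<open>S\<close> has \<open>min y z\<close> elements. This number
    is even, and half of the positions are put directly on either side of the fern.\<close>
  define t where "t = int (min y z) div 2"
  have t: "2 * t = int (min y z)" using even_sides by (auto simp: t_def min_def)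
  define S where "S = {left - t..<left} \<union> {left + 2 * int a..<left + 2 * int a + t}"
  have t0: "0 \<le> t" using t by simp
  have "card S = nat t + nat t"
    unfolding S_def by (subst card_Un_disjoint) auto
  then have card: "card S + (a + nat \<bar>line\<bar>) = height"
    using t t0 params(1,3) by (auto simp: min_def split: if_splits)
  have mir: "mirror i \<in> S \<longleftrightarrow> i \<in> S" for i
    using params(4) by (auto simp: S_def mirror_def)
  then have "mirror ` S = S" using mem_mirror_image by blast
  moreover have "S \<subseteq> free"
  proof
    fix i assume i: "i \<in> S"
    have "height \<noteq> 0" using i t params(3) by (auto simp: S_def)
    moreover have "k \<in> {0..<width} \<and> k \<notin> fern_set \<and> k \<notin> corner_set" if "k \<in> S" for k
      using that t params by (auto simp: S_def fern_set_def corner_set_def corner_def min_def width_def split: if_splits)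
    ultimately show "i \<in> free" using i mir by (auto simp: free_def base_def)
  qed
  ultimately show ?thesis using card by blast
qed

lemma vdm_free_pos: "S \<subseteq> free \<Longrightarrow> 0 < vdm S"
  using finite_free finite_subset vdm_pos by blast

lemma total_pos: "0 < total"
proof -
  obtain S where S: "S \<subseteq> free" "mirror ` S = S" "card S + (a + nat \<bar>line\<bar>) = height"
    using ex_symmetric_free by blast
  have pos: "0 < vdm S * vdm (mirror ` S) * (\<Prod>i\<in>S. weight i) / (real (h height))\<^sup>2" if "S \<subseteq> free" for S
    using that mirror_free[OF that] weight_pos h_pos[of height]
    by (intro divide_pos_pos mult_pos_pos prod_pos vdm_free_pos zero_less_power) auto
  show ?thesis unfolding total_def
    using S finite_free pos pos[OF S(1), unfolded S(2)] by (intro sum_pos2[of _ S]) (auto simp: less_imp_le)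
qed

lemma symmetric_total_pos: "0 < symmetric_total"
proof -
  obtain S where S: "S \<subseteq> free" "mirror ` S = S" "card S + (a + nat \<bar>line\<bar>) = height"
    using ex_symmetric_free by blast
  have "0 < vdm S * sqrt (\<Prod>i\<in>S. weight i) / real (h height)" if "S \<subseteq> free" for S
    using that weight_pos h_pos[of height]
    by (intro divide_pos_pos mult_pos_pos vdm_free_pos real_sqrt_gt_zero prod_pos) auto
  then show ?thesis unfolding symmetric_total_def
    using S finite_free by (intro sum_pos2[of _ S]) (auto simp: less_imp_le)
qed

theorem FC_ratios:
  assumes "balanced bs" "balanced cs"
  shows "real (M_odot (FC_centre2 x y z bs) (FC x y z bs)) / real (M_odot (FC_centre2 x y z cs) (FC x y z cs))
      = vdm (dents bs) / vdm (dents cs)"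
    and "sqrt (real (M (FC x y z bs)) / real (M (FC x y z cs))) = vdm (dents bs) / vdm (dents cs)"
proof -
  have pos: "0 < vdm (dents bs)" "0 < vdm (dents cs)" by (simp_all add: vdm_pos)
  show "real (M_odot (FC_centre2 x y z bs) (FC x y z bs)) / real (M_odot (FC_centre2 x y z cs) (FC x y z cs))
      = vdm (dents bs) / vdm (dents cs)"
    using symmetric_total_pos by (simp add: M_odot_FC assms)
  show "sqrt (real (M (FC x y z bs)) / real (M (FC x y z cs))) = vdm (dents bs) / vdm (dents cs)"
    using total_pos pos by (simp add: M_FC assms real_sqrt_divide)
qed

end

section \<open>The product formula\<close>

lemma h_Suc: "h (Suc m) = h m * fact m"
  by (simp add: h_def)

lemma h_0 [simp]: "h 0 = 1"
  by (simp add: h_def)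

lemma h_neq_0 [simp]: "h m \<noteq> 0"
  using h_pos[of m] by simp

text \<open>The distances from the last of consecutive integers to the earlier ones multiply to a
  factorial. All hyperfactorials in the product formula arise in this way.\<close>

lemma vdm_interval_nat: "vdm {u..<u + int m} = real (h m)"
proof (induction m)
  case (Suc m)
  have "{u..<u + int (Suc m)} = insert (u + int m) {u..<u + int m}" by auto
  then have "vdm {u..<u + int (Suc m)} = vdm {u..<u + int m} * (\<Prod>w\<in>{u..<u + int m}. \<bar>real_of_int (u + int m - w)\<bar>)"
    by (simp only: vdm_insert[of "{u..<u + int m}" "u + int m"]) (subst vdm_insert, auto)
  also have "(\<Prod>w\<in>{u..<u + int m}. \<bar>real_of_int (u + int m - w)\<bar>) = (\<Prod>i\<in>{1..m}. real i)"
    by (rule prod.reindex_bij_witness[where i = "\<lambda>i. u + int m - int i" and j = "\<lambda>w. nat (u + int m - w)"]) auto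
  also have "\<dots> = fact m" by (simp add: fact_prod)
  finally show ?case using Suc by (simp add: h_Suc)
qed simp

lemma vdm_interval: "u \<le> v \<Longrightarrow> vdm {u..<v} = real (h (nat (v - u)))"
  using vdm_interval_nat[of u "nat (v - u)"] by simp

text \<open>Evaluate the products over \<open>{\<alpha>..<\<delta>}\<close>, \<open>{\<alpha>..<\<gamma>}\<close>, \<open>{\<beta>..<\<delta>}\<close> and \<open>{\<beta>..<\<gamma>}\<close>: all pairs
  except those between the two outer intervals cancel.\<close>

lemma prod_interval_distances:
  assumes "\<alpha> \<le> \<beta>" "\<beta> \<le> \<gamma>" "\<gamma> \<le> \<delta>"
  shows "(\<Prod>u\<in>{\<alpha>..<\<beta>}. \<Prod>v\<in>{\<gamma>..<\<delta>}. \<bar>real_of_int (u - v)\<bar>)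
    = real (h (nat (\<delta> - \<alpha>))) * real (h (nat (\<gamma> - \<beta>))) / (real (h (nat (\<delta> - \<beta>))) * real (h (nat (\<gamma> - \<alpha>))))"
proof -
  define X where "X B = (\<Prod>u\<in>{\<alpha>..<\<beta>}. \<Prod>v\<in>B. \<bar>real_of_int (u - v)\<bar>)" for B
  have un: "real (h (nat (v - \<alpha>))) = real (h (nat (\<beta> - \<alpha>))) * real (h (nat (v - \<beta>))) * X {\<beta>..<v}" if "\<beta> \<le> v" for v
  proof -
    have "{\<alpha>..<v} = {\<alpha>..<\<beta>} \<union> {\<beta>..<v}" using assms that by auto
    then have "vdm {\<alpha>..<v} = vdm {\<alpha>..<\<beta>} * vdm {\<beta>..<v} * X {\<beta>..<v}"
      by (simp add: X_def) (subst vdm_Un, auto)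
    then show ?thesis using assms that by (simp add: vdm_interval)
  qed
  have "{\<beta>..<\<delta>} = {\<beta>..<\<gamma>} \<union> {\<gamma>..<\<delta>}" using assms by auto
  then have "X {\<beta>..<\<delta>} = X {\<beta>..<\<gamma>} * X {\<gamma>..<\<delta>}"
    unfolding X_def prod.distrib[symmetric] by (intro prod.cong refl) (simp, subst prod.union_disjoint, auto)
  then have "real (h (nat (\<delta> - \<alpha>))) * real (h (nat (\<gamma> - \<beta>))) = X {\<gamma>..<\<delta>} * (real (h (nat (\<delta> - \<beta>))) * real (h (nat (\<gamma> - \<alpha>))))"
    using un[of \<delta>] un[of \<gamma>] assms by simp
  then show ?thesis unfolding X_def[symmetric] by (simp add: field_simps)
qed

lemma prod_double: "(\<Prod>p<2 * m. f p) = (\<Prod>l<m. f (2 * l) * f (Suc (2 * l)) :: real)" for m :: nat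
  by (induction m) (simp_all add: mult_ac)

text \<open>The factors of \<open>s\<close>, indexed by endpoints of lobes: \<open>p < q\<close>
  stands for the block of entries \<open>p\<close> to \<open>q - 1\<close>, whose length decides
  between numerator and denominator.\<close>

definition hsign :: "nat list \<Rightarrow> nat \<Rightarrow> nat \<Rightarrow> real" where
  "hsign bs p q = (if odd (q - p) then id else inverse) (real (h (sum_list (take q bs) - sum_list (take p bs))))"

lemma sum_list_take_mono: "p \<le> q \<Longrightarrow> sum_list (take p bs) \<le> (sum_list (take q bs) :: nat)"
proof -
  assume "p \<le> q"
  then have "take p bs = take p (take q bs)" by (simp add: min_def)
  then show ?thesis by (metis append_take_drop_id le_add1 sum_list_append)
qed

lemma sum_nth_eq_take:
  "i \<le> j \<Longrightarrow> j < length bs \<Longrightarrow> (\<Sum>t = i..j. bs ! t) = sum_list (take (Suc j) bs) - (sum_list (take i bs) :: nat)"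
proof (induction j rule: dec_induct)
  case base
  then show ?case by (simp add: take_Suc_conv_app_nth)
next
  case (step j)
  have "sum_list (take i bs) \<le> sum_list (take (Suc j) bs)" using step by (intro sum_list_take_mono) auto
  then show ?case using step by (simp add: take_Suc_conv_app_nth)
qed

text \<open>The block from \<open>i\<close> to \<open>j\<close> corresponds to the endpoints
  \<open>i\<close> and \<open>Suc j\<close>. Dropping the last entry, as \<open>s\<close> does for
  even length, keeps \<open>q\<close> below \<open>2 * k\<close>.\<close>

lemma s_eq_hsign:
  assumes "length bs = 2 * k" "0 < k"
  shows "s bs * real (h (odd_sum bs)) = (\<Prod>q<2 * k. \<Prod>p<q. hsign bs p q)"
proof -
  let ?cs = "butlast bs" and ?D = "\<lambda>p q. real (h (sum_list (take q bs) - sum_list (take p bs)))"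
  have len: "length ?cs = 2 * k - 1" using assms by simp
  \<comment> \<open>The dropped entry has the odd index \<open>2 * k - 1\<close> and does not
    contribute.\<close>
  have odd_sum: "odd_sum ?cs = odd_sum bs"
  proof -
    have "i < length ?cs \<and> even i \<longleftrightarrow> i < length bs \<and> even i" for i
      unfolding len assms(1) by presburger
    then have eq: "{i. i < length ?cs \<and> even i} = {i. i < length bs \<and> even i}"
      by (rule Collect_cong)
    show ?thesis unfolding odd_sum_def
    proof (rule sum.cong[OF eq])
      fix i assume "i \<in> {i. i < length bs \<and> even i}"
      then have "i < length ?cs" unfolding eq[symmetric] by simp
      then show "?cs ! i = bs ! i" by (rule nth_butlast)
    qed
  qed
  have sums: "(\<Sum>t = i..j. ?cs ! t) = sum_list (take (Suc j) bs) - sum_list (take i bs)"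
    if "i \<le> j" "j < length ?cs" for i j
  proof -
    have "(\<Sum>t = i..j. ?cs ! t) = (\<Sum>t = i..j. bs ! t)"
      using that by (intro sum.cong) (auto simp: nth_butlast)
    then show ?thesis using sum_nth_eq_take[of i j bs] that len assms by simp
  qed
  have re: "(\<Prod>(i, j) | i \<le> j \<and> j < length ?cs \<and> Q (j - i + 1). real (h (\<Sum>t=i..j. ?cs ! t)))
      = (\<Prod>(q, p) | q < 2 * k \<and> p < q \<and> Q (q - p). ?D p q)" for Q
    by (rule prod.reindex_bij_witness[where i = "\<lambda>(q, p). (p, q - 1)" and j = "\<lambda>(i, j). (Suc j, i)"])
      (use sums len in \<open>auto simp: Suc_diff_le Suc_diff_Suc\<close>)
  let ?P = "SIGMA q:{..<2 * k}. {..<q}"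
  have "(\<Prod>q<2 * k. \<Prod>p<q. hsign bs p q) = (\<Prod>(q, p)\<in>?P. hsign bs p q)"
    by (rule prod.Sigma) auto
  also have "\<dots> = (\<Prod>(q, p)\<in>?P. (if odd (q - p) then ?D p q else 1) * (if even (q - p) then inverse (?D p q) else 1))"
    by (intro prod.cong) (auto simp: hsign_def)
  also have "\<dots> = (\<Prod>(q, p)\<in>?P. if odd (q - p) then ?D p q else 1) * (\<Prod>(q, p)\<in>?P. if even (q - p) then inverse (?D p q) else 1)"
    by (simp add: case_prod_unfold prod.distrib)
  also have "(\<Prod>(q, p)\<in>?P. if odd (q - p) then ?D p q else 1) = (\<Prod>(q, p) | q < 2 * k \<and> p < q \<and> odd (q - p). ?D p q)"
    by (rule prod.mono_neutral_cong_right) (auto split: if_splits)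
  also have "(\<Prod>(q, p)\<in>?P. if even (q - p) then inverse (?D p q) else 1) = (\<Prod>(q, p) | q < 2 * k \<and> p < q \<and> even (q - p). inverse (?D p q))"
    by (rule prod.mono_neutral_cong_right) (auto split: if_splits)
  also have "\<dots> = inverse (\<Prod>(q, p) | q < 2 * k \<and> p < q \<and> even (q - p). ?D p q)"
    by (simp add: case_prod_unfold prod_inversef[symmetric] comp_def)
  finally have prods: "(\<Prod>q<2 * k. \<Prod>p<q. hsign bs p q)
      = (\<Prod>(q, p) | q < 2 * k \<and> p < q \<and> odd (q - p). ?D p q)
        * inverse (\<Prod>(q, p) | q < 2 * k \<and> p < q \<and> even (q - p). ?D p q)" .
  have "s bs = s_odd ?cs" using assms(1) by (simp add: s_def)
  also have "\<dots> = (\<Prod>q<2 * k. \<Prod>p<q. hsign bs p q) * (1 / real (h (odd_sum bs)))"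
    unfolding s_odd_def re[of odd] re[of even] odd_sum prods divide_inverse by (rule refl)
  finally show ?thesis by simp
qed

context fern_cored_hexagon
begin

text \<open>Up to the reflection of the fern, the arguments of \<open>h\<close> in
  \<open>P m\<close> and \<open>Q m\<close> are the distances from the lobe endpoint at partial sum
  \<open>m\<close> to the two ends of the corner interval.\<close>

definition P :: "nat \<Rightarrow> real" where "P m = real (h ((x + y) div 2 + m))"
definition Q :: "nat \<Rightarrow> real" where "Q m = real (h ((x + z) div 2 + m))"

lemma PQ_neq_0 [simp]: "P m \<noteq> 0" "Q m \<noteq> 0"
  by (simp_all add: P_def Q_def)

lemma left_nat: "left = int ((x + y) div 2)" "left + line = int ((x + z) div 2)"
proof -
  obtain x' y' z' where "x = 2 * x'" "y = 2 * y'" "z = 2 * z'"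
    using even_sides by (auto elim!: evenE)
  then show "left = int ((x + y) div 2)" "left + line = int ((x + z) div 2)"
    unfolding line_def left_def by simp_all
qed

text \<open>The parities fit: the outermost and the innermost pair of endpoints have odd index
  difference and belong to the numerator, the other two pairs have even difference and belong to the
  denominator.\<close>

lemma prod_lobe_distances:
  assumes "l < m"
  shows "(\<Prod>u\<in>lobe bs (2 * l). \<Prod>v\<in>lobe bs (2 * m). \<bar>real_of_int (u - v)\<bar>)
    = hsign bs (2 * l) (2 * m) * hsign bs (Suc (2 * l)) (2 * m)
      * (hsign bs (2 * l) (Suc (2 * m)) * hsign bs (Suc (2 * l)) (Suc (2 * m)))"
proof -
  have "sum_list (take (2 * l) bs) \<le> sum_list (take (Suc (2 * l)) bs)"
    "sum_list (take (Suc (2 * l)) bs) \<le> sum_list (take (2 * m) bs)"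
    "sum_list (take (2 * m) bs) \<le> sum_list (take (Suc (2 * m)) bs)"
    using assms by (auto intro!: sum_list_take_mono)
  then show ?thesis
    using assms unfolding lobe_def
    by (subst prod_interval_distances) (auto simp: hsign_def nat_diff_distrib' divide_inverse mult_ac of_nat_diff[symmetric] simp del: of_nat_diff)
qed

text \<open>A new lobe adds the endpoints \<open>2 * m\<close> and \<open>Suc (2 * m)\<close>. Its
  own product of distances accounts for this pair, and its distances to the earlier lobes account
  for the pairs with earlier endpoints.\<close>

lemma vdm_even_lobes:
  "2 * m \<le> length bs \<Longrightarrow> vdm (\<Union>l<m. lobe bs (2 * l)) = (\<Prod>q<2 * m. \<Prod>p<q. hsign bs p q)"
proof (induction m)
  case (Suc m)
  let ?U = "\<Union>l<m. lobe bs (2 * l)" and ?L = "lobe bs (2 * m)"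
  have disj: "lobe bs (2 * l) \<inter> lobe bs (2 * l') = {}" if "l < l'" "l' \<le> m" for l l'
    using that Suc.prems by (intro lobe_disjoint) auto
  have fin: "finite (lobe bs l)" for l by (simp add: lobe_def)
  have "(\<Union>l<Suc m. lobe bs (2 * l)) = ?U \<union> ?L" by (auto simp: lessThan_Suc)
  then have "vdm (\<Union>l<Suc m. lobe bs (2 * l)) = vdm ?U * vdm ?L * (\<Prod>u\<in>?U. \<Prod>v\<in>?L. \<bar>real_of_int (u - v)\<bar>)"
    using disj[of _ m] fin by (simp only:) (rule vdm_Un, auto)
  also have "(\<Prod>u\<in>?U. \<Prod>v\<in>?L. \<bar>real_of_int (u - v)\<bar>)
      = (\<Prod>l<m. \<Prod>u\<in>lobe bs (2 * l). \<Prod>v\<in>?L. \<bar>real_of_int (u - v)\<bar>)"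
  proof (rule prod.UNION_disjoint)
    have "lobe bs (2 * l) \<inter> lobe bs (2 * l') = {}" if "l < m" "l' < m" "l \<noteq> l'" for l l'
      using disj[of l l'] disj[of l' l] that by (cases l l' rule: linorder_cases) auto
    then show "\<forall>l\<in>{..<m}. \<forall>l'\<in>{..<m}. l \<noteq> l' \<longrightarrow> lobe bs (2 * l) \<inter> lobe bs (2 * l') = {}" by blast
  qed (use fin in auto)
  also have "\<dots> = (\<Prod>l<m. hsign bs (2 * l) (2 * m) * hsign bs (Suc (2 * l)) (2 * m)
      * (hsign bs (2 * l) (Suc (2 * m)) * hsign bs (Suc (2 * l)) (Suc (2 * m))))"
    by (rule prod.cong[OF refl], rule prod_lobe_distances) simp
  also have "\<dots> = (\<Prod>p<2 * m. hsign bs p (2 * m)) * (\<Prod>p<2 * m. hsign bs p (Suc (2 * m)))"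
    by (simp add: prod_double prod.distrib)
  also have "vdm ?L = hsign bs (2 * m) (Suc (2 * m))"
    using sum_list_take_mono[of "2 * m" "Suc (2 * m)" bs]
    by (simp add: lobe_def vdm_interval hsign_def nat_diff_distrib')
  finally show ?case using Suc by (simp add: mult_ac)
qed simp

lemma up_lobes_even: "length bs = 2 * k \<Longrightarrow> up_lobes bs = (\<Union>l<k. lobe bs (2 * l))"
proof -
  assume len: "length bs = 2 * k"
  have "{l. l < length bs \<and> even l} = (\<lambda>l. 2 * l) ` {..<k}"
    using len by (auto elim!: evenE)
  then show ?thesis by (simp add: up_lobes_def)
qed

text \<open>The factor \<open>h a\<close> undoes the final quotient in the definition of
  \<open>s\<close>.\<close>

lemma vdm_up_lobes:
  assumes "length bs = 2 * k" "0 < k" "balanced bs"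
  shows "vdm (up_lobes bs) = s bs * real (h a)"
  using s_eq_hsign[OF assms(1,2)] vdm_even_lobes[of k bs] assms
  by (simp add: up_lobes_even odd_sum_balanced)

text \<open>Each lobe endpoint yields a quotient, but among those with even index the formula leaves
  out the ends of the whole fern. The one that does occur, at partial sum \<open>2 * a\<close> or 0,
  is set apart here; it is the same for all ferns.\<close>

definition corner_factor :: real where
  "corner_factor = (if 0 \<le> line then P (2 * a) / Q (2 * a) else P 0 / Q 0)"

lemma corner_factor_neq_0: "corner_factor \<noteq> 0"
  by (simp add: corner_factor_def)

lemma prod_corner_distances:
  assumes len: "length bs = 2 * k" "0 < k" and b: "balanced bs"
  defines "c \<equiv> \<lambda>i. sum_list (take i bs)"
  shows "(\<Prod>u\<in>up_lobes bs. \<Prod>v\<in>corner_set. \<bar>real_of_int (u - v)\<bar>)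
    = (\<Prod>l<k. P (c (2 * l + 1)) / Q (c (2 * l + 1))) * (\<Prod>l\<in>{1..<k}. Q (c (2 * l)) / P (c (2 * l))) / corner_factor"
proof -
  let ?r = "\<lambda>m. P m / Q m"
  have fin: "finite (lobe bs l)" for l by (simp add: lobe_def)
  have c_mono: "i \<le> j \<Longrightarrow> c i \<le> c j" for i j unfolding c_def by (rule sum_list_take_mono)
  have c_last: "c (2 * k) = 2 * a" using len b by (simp add: c_def balanced_def)
  have c_rev: "2 * a - c i = c (2 * k - i)" if "i \<le> 2 * k" for i
    using sum_list_take_rev[of bs i] b len by (simp add: c_def balanced_def)
  have c_le: "c i \<le> 2 * a" if "i \<le> 2 * k" for i using c_mono[OF that] c_last by simp
  have "(\<Prod>u\<in>up_lobes bs. \<Prod>v\<in>corner_set. \<bar>real_of_int (u - v)\<bar>)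
      = (\<Prod>l<k. \<Prod>u\<in>lobe bs (2 * l). \<Prod>v\<in>corner_set. \<bar>real_of_int (u - v)\<bar>)"
    unfolding up_lobes_even[OF len(1)]
  proof (rule prod.UNION_disjoint)
    have "lobe bs (2 * l) \<inter> lobe bs (2 * l') = {}" if "l < k" "l' < k" "l \<noteq> l'" for l l'
      using lobe_disjoint[of "2 * l" "2 * l'" bs] lobe_disjoint[of "2 * l'" "2 * l" bs] that len
      by (cases l l' rule: linorder_cases) auto
    then show "\<forall>l\<in>{..<k}. \<forall>l'\<in>{..<k}. l \<noteq> l' \<longrightarrow> lobe bs (2 * l) \<inter> lobe bs (2 * l') = {}" by blast
  qed (use fin in auto)
  also have "\<dots> = (\<Prod>l<k. ?r (c (2 * l + 1))) / ((\<Prod>l\<in>{1..<k}. ?r (c (2 * l))) * corner_factor)"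
  proof (cases "0 \<le> line")
    case True
    have "(\<Prod>u\<in>lobe bs (2 * l). \<Prod>v\<in>corner_set. \<bar>real_of_int (u - v)\<bar>)
        = ?r (2 * a - c (2 * l + 1)) / ?r (2 * a - c (2 * l))" if l: "l < k" for l
    proof -
      have le: "c (2 * l) \<le> c (2 * l + 1)" "c (2 * l + 1) \<le> 2 * a"
        using l by (auto intro!: c_mono c_le)
      have nat_eq: "nat (centre + line - (left + int (c i))) = (x + z) div 2 + (2 * a - c i)"
        "nat (centre - (left + int (c i))) = (x + y) div 2 + (2 * a - c i)" if "c i \<le> 2 * a" for i
        using that left_nat params(4) by auto
      have "corner_set = {centre..<centre + line}"
        using True by (simp add: corner_set_def corner_def)
      moreover have "lobe bs (2 * l) = {left + int (c (2 * l))..<left + int (c (2 * l + 1))}"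
        by (simp add: lobe_def c_def)
      moreover have "left + int (c (2 * l + 1)) \<le> centre"
        using le params(2,4) by auto
      ultimately have "(\<Prod>u\<in>lobe bs (2 * l). \<Prod>v\<in>corner_set. \<bar>real_of_int (u - v)\<bar>)
          = real (h (nat (centre + line - (left + int (c (2 * l))))))
            * real (h (nat (centre - (left + int (c (2 * l + 1))))))
            / (real (h (nat (centre + line - (left + int (c (2 * l + 1))))))
            * real (h (nat (centre - (left + int (c (2 * l)))))))"
        using le True by (simp only:) (rule prod_interval_distances, auto)
      then show ?thesis
        using nat_eq[OF le(2)] nat_eq[OF order.trans[OF le]] by (simp add: P_def Q_def mult.commute)
    qed
    \<comment> \<open>Distances to a corner on the right are measured from the right end of the
      fern. The palindrome turns \<open>2 * a - c i\<close> into \<open>c (2 * k - i)\<close>, and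
      reversing the order of the lobes restores partial sums from the left.\<close>
    then have "(\<Prod>l<k. \<Prod>u\<in>lobe bs (2 * l). \<Prod>v\<in>corner_set. \<bar>real_of_int (u - v)\<bar>)
        = (\<Prod>l<k. ?r (c (2 * k - (2 * l + 1))) / ?r (c (2 * k - 2 * l)))"
      by (intro prod.cong) (auto simp: c_rev)
    also have "\<dots> = (\<Prod>l<k. ?r (c (2 * l + 1)) / ?r (c (2 * Suc l)))"
      by (rule prod.reindex_bij_witness[where i = "\<lambda>l. k - 1 - l" and j = "\<lambda>l. k - 1 - l"])
        (auto simp: algebra_simps Suc_diff_le diff_mult_distrib2 numeral_2_eq_2 Suc_diff_Suc)
    also have "\<dots> = (\<Prod>l<k. ?r (c (2 * l + 1))) / (\<Prod>l<k. ?r (c (2 * Suc l)))"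
      by (rule prod_dividef)
    also have "(\<Prod>l<k. ?r (c (2 * Suc l))) = (\<Prod>l\<in>{1..<Suc k}. ?r (c (2 * l)))"
      by (rule prod.reindex_bij_witness[where i = "\<lambda>l. l - 1" and j = Suc]) auto
    also have "\<dots> = (\<Prod>l\<in>{1..<k}. ?r (c (2 * l))) * corner_factor"
      using len(2) True by (simp add: corner_factor_def c_last)
    finally show ?thesis .
  next
    case False
    have "(\<Prod>u\<in>lobe bs (2 * l). \<Prod>v\<in>corner_set. \<bar>real_of_int (u - v)\<bar>)
        = ?r (c (2 * l + 1)) / ?r (c (2 * l))" if l: "l < k" for l
    proof -
      have le: "c (2 * l) \<le> c (2 * l + 1)" by (auto intro!: c_mono)
      have nat_eq: "nat (left + int (c i)) = (x + y) div 2 + c i"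
        "nat (left + int (c i) + line) = (x + z) div 2 + c i" for i
        using left_nat by auto
      have "corner_set = {0..<- line}"
        using False by (simp add: corner_set_def corner_def)
      moreover have "lobe bs (2 * l) = {left + int (c (2 * l))..<left + int (c (2 * l + 1))}"
        by (simp add: lobe_def c_def)
      moreover have "- line \<le> left + int (c (2 * l))"
        using left_nat(2) by auto
      \<comment> \<open>The corner is now to the left of the fern and takes the place of the left
        interval, so the two products are exchanged.\<close>
      ultimately have "(\<Prod>v\<in>corner_set. \<Prod>u\<in>lobe bs (2 * l). \<bar>real_of_int (v - u)\<bar>)
          = real (h (nat (left + int (c (2 * l + 1)) - 0))) * real (h (nat (left + int (c (2 * l)) - - line)))
            / (real (h (nat (left + int (c (2 * l + 1)) - - line))) * real (h (nat (left + int (c (2 * l)) - 0))))"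
        using le False by (simp only:) (rule prod_interval_distances, auto)
      moreover have "(\<Prod>u\<in>lobe bs (2 * l). \<Prod>v\<in>corner_set. \<bar>real_of_int (u - v)\<bar>)
          = (\<Prod>v\<in>corner_set. \<Prod>u\<in>lobe bs (2 * l). \<bar>real_of_int (v - u)\<bar>)"
        by (subst prod.swap) (simp add: abs_minus_commute)
      ultimately show ?thesis using nat_eq by (simp add: P_def Q_def)
    qed
    then have "(\<Prod>l<k. \<Prod>u\<in>lobe bs (2 * l). \<Prod>v\<in>corner_set. \<bar>real_of_int (u - v)\<bar>)
        = (\<Prod>l<k. ?r (c (2 * l + 1)) / ?r (c (2 * l)))"
      by (intro prod.cong) auto
    also have "\<dots> = (\<Prod>l<k. ?r (c (2 * l + 1))) / (\<Prod>l<k. ?r (c (2 * l)))"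
      by (rule prod_dividef)
    also have "(\<Prod>l<k. ?r (c (2 * l))) = (\<Prod>l\<in>{1..<k}. ?r (c (2 * l))) * corner_factor"
      using len(2) False
      by (simp add: lessThan_atLeast0 prod.atLeast_Suc_lessThan corner_factor_def c_def)
    finally show ?thesis .
  qed
  also have "\<dots> = (\<Prod>l<k. ?r (c (2 * l + 1))) * (\<Prod>l\<in>{1..<k}. Q (c (2 * l)) / P (c (2 * l))) / corner_factor"
    by (simp add: prod_dividef)
  finally show ?thesis .
qed

lemma vdm_dents:
  assumes "balanced bs"
  shows "vdm (dents bs) = vdm (up_lobes bs) * vdm corner_set
    * (\<Prod>u\<in>up_lobes bs. \<Prod>v\<in>corner_set. \<bar>real_of_int (u - v)\<bar>)"
  unfolding dents_def using up_lobes_subset[OF assms] corner_fern_disjoint by (intro vdm_Un) auto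

text \<open>For \<open>[a, a]\<close> the only up-pointing lobe is one interval, with the single
  quotient \<open>P a / Q a\<close>; its inverse is the prefactor. The factors \<open>h a\<close>,
  \<open>vdm corner_set\<close> and \<open>corner_factor\<close> cancel.\<close>

theorem vdm_dents_ratio:
  assumes len: "length bs = 2 * k" "0 < k" and b: "balanced bs"
  defines "c \<equiv> \<lambda>i. sum_list (take i bs)"
  shows "vdm (dents bs) / vdm (dents [a, a])
    = s bs * (Q a / P a) * (\<Prod>l<k. P (c (2 * l + 1)) / Q (c (2 * l + 1)))
      * (\<Prod>l\<in>{1..<k}. Q (c (2 * l)) / P (c (2 * l)))"
proof -
  have b2: "balanced [a, a]" by (simp add: balanced_def)
  have "up_lobes [a, a] = {left..<left + int a}"
    using up_lobes_even[of "[a, a]" 1] by (simp add: lobe_def lessThan_Suc)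
  then have v2: "vdm (up_lobes [a, a]) = real (h a)" by (simp add: vdm_interval)
  have "vdm (dents [a, a]) = real (h a) * vdm corner_set * (P a / Q a / corner_factor)"
    using prod_corner_distances[of "[a, a]" 1] b2 by (simp add: vdm_dents v2 lessThan_Suc)
  moreover have "vdm corner_set \<noteq> 0" using vdm_pos[of corner_set] by simp
  ultimately show ?thesis
    using prod_corner_distances[OF len b] corner_factor_neq_0
    by (simp add: vdm_dents[OF b] vdm_up_lobes[OF len b] c_def)
qed

end

theorem theorem2p1:
  fixes x y z k a :: nat and as bs :: "nat list"
  assumes "even x" and "even y" and "even z"
    and "k \<ge> 1" and "length as = k"
    and "bs = as @ rev as"
    and "a = sum_list as"
  shows "real (M_odot (FC_centre2 x y z bs) (FC x y z bs))
           / real (M_odot (FC_centre2 x y z [a, a]) (FC x y z [a, a]))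
         = sqrt (real (M (FC x y z bs)) / real (M (FC x y z [a, a])))
       \<and> sqrt (real (M (FC x y z bs)) / real (M (FC x y z [a, a])))
         = s bs * (real (h ((x + z) div 2 + a)) / real (h ((x + y) div 2 + a)))
           * (\<Prod>i | 1 \<le> 2 * i + 1 \<and> 2 * i + 1 \<le> 2 * k.
                real (h ((x + y) div 2 + sum_list (take (2 * i + 1) bs)))
                / real (h ((x + z) div 2 + sum_list (take (2 * i + 1) bs))))
           * (\<Prod>i | 1 < 2 * i \<and> 2 * i < 2 * k.
                real (h ((x + z) div 2 + sum_list (take (2 * i) bs)))
                / real (h ((x + y) div 2 + sum_list (take (2 * i) bs))))"
proof -
  interpret fern_cored_hexagon x y z a
    using assms by unfold_locales auto
  have b: "balanced bs" "balanced [a, a]"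
    unfolding balanced_def using assms(6,7) by simp_all
  have len: "length bs = 2 * k" "0 < k" using assms by auto
  have "{i. 1 \<le> 2 * i + 1 \<and> 2 * i + 1 \<le> 2 * k} = {..<k}" "{i. 1 < 2 * i \<and> 2 * i < 2 * k} = {1..<k}"
    by auto
  then show ?thesis
    using FC_ratios[OF b] vdm_dents_ratio[OF len b(1)] by (simp only: P_def Q_def)
qed

end
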